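(* Let $A=[\mathbf{a}_1,\dots,\mathbf{a}_n]\in\mathbb{Z}^{m\times n}$ have bouquets $B_1,\dots,B_s$, let $A_B=[\mathbf{a}_{B_1},\dots,\mathbf{a}_{B_s}]$, and suppose that $I_A$ is a stable toric ideal. Then the bijective correspondence between the elements of $\operatorname{Ker}_{\mathbb{Z}}(A_B)$ and $\operatorname{Ker}_{\mathbb{Z}}(A)$ given by $$\mathbf{u}=(u_1,\dots,u_s)\mapsto B(\mathbf{u})=\mathbf{c}_{B_1}u_1+\cdots+\mathbf{c}_{B_s}u_s$$ is preserved when we restrict to any of the following sets: the Graver basis, the circuits, the indispensable binomials, the minimal Markov bases, the reduced Gröbner bases (and the universal Gröbner basis). That is, $B$ maps the Graver basis (respectively, the set of circuits, the set of indispensable binomials, the universal Gröbner basis) of $A_B$ bijectively onto that of $A$, and $\mathcal{M}\mapsto\{B(\mathbf{u}):\mathbf{u}\in\mathcal{M}\}$ is a bijection from the set of minimal Markov bases (respectively, reduced Gröbner bases) of $A_B$ onto the set of minimal Markov bases (respectively, reduced Gröbner bases) of $A$.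
   Context: For $A=[\mathbf{a}_1,\dots,\mathbf{a}_n]\in\mathbb{Z}^{m\times n}$ let $\operatorname{Ker}_{\mathbb{Z}}(A)=\{\mathbf{u}\in\mathbb{Z}^n:A\mathbf{u}=\mathbf{0}\}$. For an integer vector write $\mathbf{u}=\mathbf{u}^+-\mathbf{u}^-$ with $\mathbf{u}^{\pm}$ nonnegative of disjoint support. Over a field $K$, the toric ideal of $A$ is $I_A=(\mathbf{x}^{\mathbf{u}^+}-\mathbf{x}^{\mathbf{u}^-}:\mathbf{u}\in\operatorname{Ker}_{\mathbb{Z}}(A))\subset K[x_1,\dots,x_n]$. Gale transform: let $r=\operatorname{rank}A$, fix a basis $G_1,\dots,G_{n-r}$ of the lattice $\operatorname{Ker}_{\mathbb{Z}}(A)$, and let $G(\mathbf{a}_i)\in\mathbb{Z}^{n-r}$ be the $i$-th row of the matrix with columns $G_1,\dots,G_{n-r}$. Bouquets: a co-vector of $A$ is a vector $(\mathbf{v}\cdot\mathbf{a}_1,\dots,\mathbf{v}\cdot\mathbf{a}_n)$ with $\mathbf{v}\in\mathbb{Z}^m$; a co-circuit is a nonzero co-vector of minimal support. $\mathbf{a}_i$ is free if $\{i\}$ is the support of a co-circuit (equivalently $G(\mathbf{a}_i)=\mathbf{0}$). The bouquet graph $G_A$ has vertices $\mathbf{a}_1,\dots,\mathbf{a}_n$ (distinguished by their indices), and $\{\mathbf{a}_i,\mathbf{a}_j\}$, $i\neq j$, is an edge if there is a co-vector with support $\{i,j\}$. When such a co-vector is a co-circuit, the edge is in $E_A^+$ if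 its two nonzero coordinates have distinct signs and in $E_A^-$ if they have the same sign; the remaining edges join free vectors. The bouquets of $A$ are the connected components of $G_A$. The free vectors, if any, form one bouquet, the free bouquet; all others are non-free. A non-free bouquet is mixed if it contains an edge of $E_A^-$, and non-mixed if it is an isolated vertex or all its edges are in $E_A^+$. The toric ideal $I_A$ is stable if all the non-free bouquets of $A$ are non-mixed. Vectors $\mathbf{c}_B$, $\mathbf{a}_B$: if $B$ is free, $\mathbf{c}_B\in\mathbb{Z}^n$ is any (fixed) vector with support $\{i:\mathbf{a}_i\in B\}$ and positive first nonzero coordinate. If $B$ is non-free, choose a coordinate $j$ with $G(\mathbf{a}_i)_j\neq0$ for all $\mathbf{a}_i\in B$ (these Gale vectors are nonzero and pairwise proportional), let $g_j=\gcd(G(\mathbf{a}_i)_j:\mathbf{a}_i\in B)$, let $i_0$ be the smallest index with $\mathbf{a}_{i_0}\in B$, let $\varepsilon$ be the sign of $G(\mathbf{a}_{i_0})_j$, and let $\mathbf{c}_B\in\mathbb{Z}^n$ have $i$-th coordinate $\varepsilon G(\mathbf{a}_i)_j/g_j$ if $\mathbf{a}_i\in B$ and $0$ otherwise (independent of $j$). Set $\mathbf{a}_B=\sum_{i=1}^n(\mathbf{c}_B)_i\mathbf{a}_i$. Bases (a vector $\mathbf{u}\in\operatorname{Ker}_{\mathbb{Z}}(A)$ is identified with the binomial $\mathbf{x}^{\mathbf{u}^+}-\mathbf{x}^{\mathbf{u}^-}$, and "bases of $A$" means those of $I_A$): the Graver basis is the set of nonzero $\mathbf{u}\in\operatorname{Ker}_{\mathbb{Z}}(A)$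 that cannot be written $\mathbf{u}=\mathbf{v}+\mathbf{w}$ with nonzero $\mathbf{v},\mathbf{w}\in\operatorname{Ker}_{\mathbb{Z}}(A)$, $\mathbf{u}^+=\mathbf{v}^++\mathbf{w}^+$ and $\mathbf{u}^-=\mathbf{v}^-+\mathbf{w}^-$. Circuits are nonzero vectors of $\operatorname{Ker}_{\mathbb{Z}}(A)$ of inclusion-minimal support with relatively prime coordinates. A Markov basis is a finite subset of $\operatorname{Ker}_{\mathbb{Z}}(A)$ whose binomials generate $I_A$; it is minimal if no proper subset is a Markov basis. The set of indispensable binomials is the intersection of all minimal Markov bases, where elements differing by a sign are identified. A reduced Gröbner basis is one with respect to some monomial order, its elements being written $\mathbf{x}^{\mathbf{u}^+}-\mathbf{x}^{\mathbf{u}^-}$ with leading term $\mathbf{x}^{\mathbf{u}^+}$; the universal Gröbner basis is the union of all reduced Gröbner bases. *)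

theory Defs
  imports "HOL-Analysis.Cartesian_Space" "HOL-Library.Poly_Mapping"
begin

section \<open>Integer matrices, kernels and co-vectors\<close>

text \<open>
  A matrix in \<open>Z^{m \<times> n}\<close> is an element of \<^typ>\<open>int^'n^'m\<close>; its columns are indexed by
  the finite type \<open>'n\<close>.  Only the normalisation of the vectors \<open>c_B\<close> below refers to an
  order of the columns, given by a linear order on \<open>'n\<close>.
\<close>

definition int_ker :: "int^'n^'m \<Rightarrow> (int^'n) set" where
  "int_ker A = {u. A *v u = 0}"

definition vsupp :: "int^'n \<Rightarrow> 'n set" where
  "vsupp u = {i. u $ i \<noteq> 0}"

definition covector :: "int^'n^'m \<Rightarrow> int^'n \<Rightarrow> bool" where
  "covector A w \<longleftrightarrow> (\<exists>v. w = v v* A)"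

definition cocircuit :: "int^'n^'m \<Rightarrow> int^'n \<Rightarrow> bool" where
  "cocircuit A w \<longleftrightarrow> covector A w \<and> w \<noteq> 0 \<and>
     \<not> (\<exists>w'. covector A w' \<and> w' \<noteq> 0 \<and> vsupp w' \<subset> vsupp w)"

definition free_vector :: "int^'n^'m \<Rightarrow> 'n \<Rightarrow> bool" where
  "free_vector A i \<longleftrightarrow> (\<exists>w. cocircuit A w \<and> vsupp w = {i})"


section \<open>The bouquet graph and its components\<close>

text \<open>The vertices are the column indices, so equal columns give distinct vertices.\<close>

definition bouquet_edges :: "int^'n^'m \<Rightarrow> 'n set set" where
  "bouquet_edges A = {{i, j} | i j. i \<noteq> j \<and> (\<exists>w. covector A w \<and> vsupp w = {i, j})}"

definition pos_edges :: "int^'n^'m \<Rightarrow> 'n set set" where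
  "pos_edges A = {{i, j} | i j. i \<noteq> j \<and>
     (\<exists>w. cocircuit A w \<and> vsupp w = {i, j} \<and> sgn (w $ i) \<noteq> sgn (w $ j))}"

definition neg_edges :: "int^'n^'m \<Rightarrow> 'n set set" where
  "neg_edges A = {{i, j} | i j. i \<noteq> j \<and>
     (\<exists>w. cocircuit A w \<and> vsupp w = {i, j} \<and> sgn (w $ i) = sgn (w $ j))}"

definition bouquets :: "int^'n^'m \<Rightarrow> 'n set set" where
  "bouquets A = UNIV // {(i, j). {i, j} \<in> bouquet_edges A}\<^sup>*"

definition free_bouquet :: "int^'n^'m \<Rightarrow> 'n set \<Rightarrow> bool" where
  "free_bouquet A B \<longleftrightarrow> B \<in> bouquets A \<and> B = {i. free_vector A i}"

definition nonfree_bouquet :: "int^'n^'m \<Rightarrow> 'n set \<Rightarrow> bool" where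
  "nonfree_bouquet A B \<longleftrightarrow> B \<in> bouquets A \<and> \<not> free_bouquet A B"

definition mixed :: "int^'n^'m \<Rightarrow> 'n set \<Rightarrow> bool" where
  "mixed A B \<longleftrightarrow> nonfree_bouquet A B \<and> (\<exists>e \<in> neg_edges A. e \<subseteq> B)"

definition non_mixed :: "int^'n^'m \<Rightarrow> 'n set \<Rightarrow> bool" where
  "non_mixed A B \<longleftrightarrow> nonfree_bouquet A B \<and>
     ((\<exists>i. B = {i}) \<or> (\<forall>e \<in> bouquet_edges A. e \<subseteq> B \<longrightarrow> e \<in> pos_edges A))"

definition stable_toric :: "int^'n^'m \<Rightarrow> bool" where
  "stable_toric A \<longleftrightarrow> (\<forall>B. nonfree_bouquet A B \<longrightarrow> non_mixed A B)"


section \<open>Gale transform and the bouquet matrix\<close>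

lemma module_int_vec: "module ((*s) :: int \<Rightarrow> int^'n \<Rightarrow> int^'n)"
  by unfold_locales (simp_all add: vec_eq_iff algebra_simps)

definition lattice_basis :: "(int^'n) list \<Rightarrow> (int^'n) set \<Rightarrow> bool" where
  "lattice_basis Gs L \<longleftrightarrow> distinct Gs \<and>
     \<not> module.dependent ((*s) :: int \<Rightarrow> _) (set Gs) \<and>
     module.span ((*s) :: int \<Rightarrow> _) (set Gs) = L"

definition gale :: "(int^'n) list \<Rightarrow> 'n \<Rightarrow> int list" where
  "gale Gs i = map (\<lambda>g. g $ i) Gs"

text \<open>
  \<open>bouquet_vector A Gs B c\<close> states that \<open>c\<close> is an admissible choice of \<open>c_B\<close>.
  For a free bouquet there are many; for a non-free one \<open>c\<close> is unique.
\<close>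

definition bouquet_vector ::
  "int^'n::{finite,linorder}^'m \<Rightarrow> (int^'n::{finite,linorder}) list \<Rightarrow> 'n set \<Rightarrow> int^'n::{finite,linorder} \<Rightarrow> bool" where
  "bouquet_vector A Gs B c \<longleftrightarrow>
     (if free_bouquet A B then vsupp c = B \<and> c $ Min B > 0
      else \<exists>j < length Gs. (\<forall>i \<in> B. gale Gs i ! j \<noteq> 0) \<and>
        c = (\<chi> i. if i \<in> B
                  then (sgn (gale Gs (Min B) ! j) * (gale Gs i ! j))
                         div Gcd ((\<lambda>i. gale Gs i ! j) ` B)
                  else 0))"

definition bouquet_column :: "int^'n^'m \<Rightarrow> int^'n \<Rightarrow> int^'m" where
  "bouquet_column A c = (\<Sum>i\<in>UNIV. (c $ i) *s column i A)"

definition bouquet_matrix :: "int^'n^'m \<Rightarrow> ('s \<Rightarrow> int^'n) \<Rightarrow> int^'s^'m" where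
  "bouquet_matrix A c = (\<chi> k b. bouquet_column A (c b) $ k)"

definition bouquet_map :: "('s::finite \<Rightarrow> int^'n) \<Rightarrow> int^'s \<Rightarrow> int^'n" where
  "bouquet_map c u = (\<Sum>b\<in>UNIV. (u $ b) *s c b)"


section \<open>Polynomials and toric ideals\<close>

text \<open>\<open>K[x_i : i \<in> 'n]\<close> is the whole type \<open>('n, 'k) mpoly\<close>.\<close>

type_synonym 'n pp = "'n \<Rightarrow>\<^sub>0 nat"
type_synonym ('n, 'k) mpoly = "('n \<Rightarrow>\<^sub>0 nat) \<Rightarrow>\<^sub>0 'k"

lemma module_times: "module ((*) :: 'a::comm_ring_1 \<Rightarrow> 'a \<Rightarrow> 'a)"
  by unfold_locales (simp_all add: algebra_simps)

definition ideal_gen :: "'a::comm_ring_1 set \<Rightarrow> 'a set" where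
  "ideal_gen F = module.span (*) F"

text \<open>The vectors \<open>u^+\<close> and \<open>u^-\<close>, as exponent vectors.\<close>

definition pos_part :: "int^'n::finite \<Rightarrow> 'n pp" where
  "pos_part u = Abs_poly_mapping (\<lambda>i. nat (u $ i))"

definition neg_part :: "int^'n::finite \<Rightarrow> 'n pp" where
  "neg_part u = Abs_poly_mapping (\<lambda>i. nat (- (u $ i)))"

definition binom :: "int^'n::finite \<Rightarrow> ('n, 'k::field) mpoly" where
  "binom u = Poly_Mapping.single (pos_part u) 1 - Poly_Mapping.single (neg_part u) 1"

definition toric_ideal :: "int^'n::finite^'m \<Rightarrow> ('n, 'k::field) mpoly set" where
  "toric_ideal A = ideal_gen (binom ` int_ker A)"


section \<open>Graver basis, circuits, Markov bases, indispensable binomials\<close>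

definition graver_basis :: "int^'n::finite^'m \<Rightarrow> (int^'n) set" where
  "graver_basis A = {u \<in> int_ker A. u \<noteq> 0 \<and>
     \<not> (\<exists>v \<in> int_ker A. \<exists>w \<in> int_ker A. v \<noteq> 0 \<and> w \<noteq> 0 \<and> u = v + w \<and>
          pos_part u = pos_part v + pos_part w \<and> neg_part u = neg_part v + neg_part w)}"

definition circuits :: "int^'n::finite^'m \<Rightarrow> (int^'n) set" where
  "circuits A = {u \<in> int_ker A. u \<noteq> 0 \<and>
     \<not> (\<exists>v \<in> int_ker A. v \<noteq> 0 \<and> vsupp v \<subset> vsupp u) \<and> Gcd (range (\<lambda>i. u $ i)) = 1}"

text \<open>The \<^typ>\<open>'k itself\<close> arguments carry the coefficient field.\<close>

definition markov_basis :: "'k::field itself \<Rightarrow> int^'n::finite^'m \<Rightarrow> (int^'n) set \<Rightarrow> bool" where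
  "markov_basis K A M \<longleftrightarrow> finite M \<and> M \<subseteq> int_ker A \<and>
     ideal_gen (binom ` M) = (toric_ideal A :: ('n, 'k) mpoly set)"

definition minimal_markov_bases ::
  "'k::field itself \<Rightarrow> int^'n::finite^'m \<Rightarrow> (int^'n) set set" where
  "minimal_markov_bases K A =
     {M. markov_basis K A M \<and> \<not> (\<exists>M'. M' \<subset> M \<and> markov_basis K A M')}"

text \<open>
  Minimal Markov bases are only compared up to the signs of their elements; the resulting
  set contains both representatives \<open>u\<close> and \<open>-u\<close> of each indispensable binomial.
\<close>

definition indispensables :: "'k::field itself \<Rightarrow> int^'n::finite^'m \<Rightarrow> (int^'n) set" where
  "indispensables K A =
     {u \<in> int_ker A. \<forall>M \<in> minimal_markov_bases K A. u \<in> M \<or> - u \<in> M}"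


section \<open>Reduced Groebner bases\<close>

text \<open>\<open>(s, t) \<in> r\<close> means that \<open>x^s\<close> is less than or equal to \<open>x^t\<close>.\<close>

definition monomial_order :: "('n pp \<times> 'n pp) set \<Rightarrow> bool" where
  "monomial_order r \<longleftrightarrow> linear_order r \<and> (\<forall>t. (0, t) \<in> r) \<and>
     (\<forall>s t u. (s, t) \<in> r \<longrightarrow> (s + u, t + u) \<in> r)"

text \<open>The three functions below are only meaningful for nonzero polynomials.\<close>

definition lead_exp :: "('n pp \<times> 'n pp) set \<Rightarrow> ('n, 'k::field) mpoly \<Rightarrow> 'n pp" where
  "lead_exp r f = (THE t. t \<in> Poly_Mapping.keys f \<and> (\<forall>s \<in> Poly_Mapping.keys f. (s, t) \<in> r))"

definition lead_coef :: "('n pp \<times> 'n pp) set \<Rightarrow> ('n, 'k::field) mpoly \<Rightarrow> 'k" where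
  "lead_coef r f = Poly_Mapping.lookup f (lead_exp r f)"

definition lead_term :: "('n pp \<times> 'n pp) set \<Rightarrow> ('n, 'k::field) mpoly \<Rightarrow>
  ('n, 'k) mpoly" where
  "lead_term r f = Poly_Mapping.single (lead_exp r f) (lead_coef r f)"

definition groebner_basis ::
  "('n pp \<times> 'n pp) set \<Rightarrow> ('n, 'k::field) mpoly set \<Rightarrow> ('n, 'k) mpoly set \<Rightarrow> bool" where
  "groebner_basis r I G \<longleftrightarrow> finite G \<and> G \<subseteq> I \<and>
     ideal_gen (lead_term r ` (G - {0})) = ideal_gen (lead_term r ` (I - {0}))"

definition reduced_groebner_basis ::
  "('n pp \<times> 'n pp) set \<Rightarrow> ('n, 'k::field) mpoly set \<Rightarrow> ('n, 'k) mpoly set \<Rightarrow> bool" where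
  "reduced_groebner_basis r I G \<longleftrightarrow> groebner_basis r I G \<and>
     (\<forall>p \<in> G. p \<noteq> 0 \<and> lead_coef r p = 1 \<and>
        (\<forall>t \<in> Poly_Mapping.keys p. Poly_Mapping.single t 1 \<notin> ideal_gen (lead_term r ` (G - {p}))))"

text \<open>
  Reduced Groebner bases of toric ideals consist of binomials of kernel vectors.  They are
  recorded as sets of vectors \<open>u\<close>, the sign of \<open>u\<close> being fixed by the requirement that
  \<open>x^{u^+}\<close> is the leading term (in characteristic 2 the binomial alone does not determine it).
\<close>

definition reduced_groebner_bases ::
  "'k::field itself \<Rightarrow> int^'n::finite^'m \<Rightarrow> (int^'n) set set" where
  "reduced_groebner_bases K A = {U. U \<subseteq> int_ker A \<and>
     (\<exists>r. monomial_order r \<and>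
        reduced_groebner_basis r (toric_ideal A :: ('n, 'k) mpoly set) (binom ` U) \<and>
        (\<forall>u \<in> U. lead_term r (binom u :: ('n, 'k) mpoly) = Poly_Mapping.single (pos_part u) 1))}"

definition universal_groebner_basis ::
  "'k::field itself \<Rightarrow> int^'n::finite^'m \<Rightarrow> (int^'n) set" where
  "universal_groebner_basis K A = \<Union> (reduced_groebner_bases K A)"

end

theory Submission
  imports Defs
begin

text \<open>
  Everything in the theorem depends on the matrix only through its integer kernel, so the point
  is to see how the two kernels are related.  A co-vector supported on two columns \<open>i\<close>, \<open>j\<close> of a
  bouquet forces \<open>u\<^sub>i\<close> and \<open>u\<^sub>j\<close> to be proportional for all \<open>u\<close> in the kernel, with a positive ratio
  if its two signs differ.  Hence on a non-free bouquet \<open>B\<close> of a stable ideal the vector \<open>c\<^sub>B\<close> is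
  strictly positive and primitive, and the restriction of every kernel vector to \<open>B\<close> is an integer
  multiple of it (\<open>bouquet_vector_non_mixed\<close>).  On the free bouquet kernel vectors vanish, so
  there \<open>c\<^sub>B\<close> is irrelevant and may be replaced by the all-ones vector.  With \<open>\<beta>\<close> the map from
  columns to bouquets and \<open>d\<close> the resulting positive weights, the correspondence becomes the
  stretching \<open>u \<mapsto> (d\<^sub>i u\<^bsub>\<beta>(i)\<^esub>)\<^sub>i\<close> of one kernel onto the other.

  Since \<open>d > 0\<close>, stretching commutes with positive and negative parts and with supports, and since
  \<open>d\<close> is primitive on each fibre of \<open>\<beta>\<close> it preserves the gcd of the coordinates.  This settles the
  Graver basis and the circuits.  For the ideal-theoretic notions, stretching of exponents induces
  a ring embedding of \<open>K[y]\<close>, with one variable per bouquet, into \<open>K[x]\<close>, sending each \<open>y\<^sub>b\<close> to the monomial of \<open>d\<close> restricted to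
  the fibre of \<open>b\<close>, and \<open>I\<^sub>A\<close> is the extension of the other toric ideal.  These monomials involve
  disjoint sets of variables, so \<open>K[x]\<close> is free over \<open>K[y]\<close>: a basis consists of the monomials
  \<open>x\<^sup>e\<close> divisible by none of them.  The \<open>K[y]\<close>-linear coordinate functions for this basis
  (\<open>slice\<close>) carry the proof.  The one for \<open>e = 0\<close> is a retraction of the embedding, so ideal
  membership descends; this gives the Markov bases.  Distinct slices of a polynomial come from
  disjoint sets of monomials, so the leading term of \<open>f\<close> is \<open>x\<^sup>e\<close> times the image of the leading
  term of a slice of \<open>f\<close> (\<open>lead_exp_slice\<close>).  Initial ideals are therefore extended as well, which
  gives the reduced Groebner bases, once each monomial order on \<open>K[y]\<close> is known to extend to
  \<open>K[x]\<close> (\<open>extended_order\<close>) and each order on \<open>K[x]\<close> to restrict.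
\<close>

section \<open>Ideals generated by a set\<close>

lemma ideal_gen_base: "f \<in> F \<Longrightarrow> f \<in> ideal_gen F"
  unfolding ideal_gen_def by (rule module.span_base[OF module_times])

lemma ideal_gen_mult: "f \<in> ideal_gen F \<Longrightarrow> p * f \<in> ideal_gen F"
  unfolding ideal_gen_def by (rule module.span_scale[OF module_times])

lemma ideal_gen_induct [consumes 1, case_names zero step]:
  assumes "f \<in> ideal_gen F" and "P 0" and "\<And>p x y. x \<in> F \<Longrightarrow> P y \<Longrightarrow> P (p * x + y)"
  shows "P f"
  using module.span_induct_alt[OF module_times, of f F P] assms
  unfolding ideal_gen_def by blast

lemma ideal_gen_zero: "0 \<in> ideal_gen F"
  unfolding ideal_gen_def by (rule module.span_zero[OF module_times])

lemma ideal_gen_add: "f \<in> ideal_gen F \<Longrightarrow> g \<in> ideal_gen F \<Longrightarrow> f + g \<in> ideal_gen F"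
  unfolding ideal_gen_def by (rule module.span_add[OF module_times])

lemma ideal_gen_subset_iff: "ideal_gen F \<subseteq> ideal_gen G \<longleftrightarrow> F \<subseteq> ideal_gen G"
proof
  assume "ideal_gen F \<subseteq> ideal_gen G"
  then show "F \<subseteq> ideal_gen G" using ideal_gen_base by blast
next
  assume FG: "F \<subseteq> ideal_gen G"
  show "ideal_gen F \<subseteq> ideal_gen G"
  proof
    fix f assume "f \<in> ideal_gen F"
    then show "f \<in> ideal_gen G"
      using FG by (induction rule: ideal_gen_induct)
        (auto intro: ideal_gen_zero ideal_gen_add ideal_gen_mult)
  qed
qed

lemma ideal_gen_mono: "F \<subseteq> G \<Longrightarrow> ideal_gen F \<subseteq> ideal_gen G"
  using ideal_gen_subset_iff ideal_gen_base by blast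

section \<open>Leading exponents and monomial orders\<close>

lemma mpoly_induct_add [case_names zero single add]:
  fixes f :: "('a \<Rightarrow>\<^sub>0 'b::monoid_add)"
  assumes "P 0" and "\<And>t a. P (Poly_Mapping.single t a)" and "\<And>f g. P f \<Longrightarrow> P g \<Longrightarrow> P (f + g)"
  shows "P f"
proof (induction f rule: update_induct)
  case const
  show ?case by (fact assms(1))
next
  case (update f a b)
  have "Poly_Mapping.update a b f = f + Poly_Mapping.single a b"
    using update(1)
    by (intro poly_mapping_eqI) (auto simp: lookup_update lookup_add lookup_single in_keys_iff when_def)
  then show ?case using assms update by simp
qed

lemma linear_order_finite_max:
  assumes "linear_order r" and "finite S" and "S \<noteq> {}"
  shows "\<exists>t\<in>S. \<forall>s\<in>S. (s, t) \<in> r"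
  using assms(2,3)
proof (induction rule: finite_ne_induct)
  case (singleton x)
  then show ?case using assms(1) by (auto simp: order_on_defs refl_on_def)
next
  case (insert x S)
  then obtain t where t: "t \<in> S" "\<forall>s\<in>S. (s, t) \<in> r" by blast
  have refl: "(x, x) \<in> r" "(t, t) \<in> r" and trans: "trans r"
    using assms(1) by (auto simp: order_on_defs refl_on_def)
  have "(x, t) \<in> r \<or> (t, x) \<in> r"
    using assms(1) refl by (cases "x = t") (auto simp: order_on_defs total_on_def)
  then show ?case
    using t refl transD[OF trans] by (metis insert_iff)
qed

lemma lead_exp_eqI:
  assumes "linear_order r" and "t \<in> Poly_Mapping.keys f" and "\<And>s. s \<in> Poly_Mapping.keys f \<Longrightarrow> (s, t) \<in> r"
  shows "lead_exp r f = t"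
  unfolding lead_exp_def
  by (rule the_equality) (use assms in \<open>auto simp: order_on_defs dest: antisymD\<close>)

lemma lead_exp_max:
  assumes "linear_order r" and "f \<noteq> 0"
  shows "lead_exp r f \<in> Poly_Mapping.keys f"
    and "s \<in> Poly_Mapping.keys f \<Longrightarrow> (s, lead_exp r f) \<in> r"
proof -
  have "Poly_Mapping.keys f \<noteq> {}" using assms(2) by simp
  then obtain t where "t \<in> Poly_Mapping.keys f" "\<forall>s\<in>Poly_Mapping.keys f. (s, t) \<in> r"
    using linear_order_finite_max[OF assms(1)] finite_keys by blast
  moreover from this have "lead_exp r f = t" using lead_exp_eqI[OF assms(1)] by blast
  ultimately show "lead_exp r f \<in> Poly_Mapping.keys f"
    and "s \<in> Poly_Mapping.keys f \<Longrightarrow> (s, lead_exp r f) \<in> r" by auto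
qed

text \<open>
  This order serves as the tie-break in the extension of monomial orders below.
\<close>

lemma monomial_order_lex: "monomial_order {(s, t :: 'n::linorder pp). s \<le> t}"
proof -
  have "0 \<le> t" for t :: "'n pp"
  proof (rule ccontr)
    assume "\<not> 0 \<le> t"
    then have "t < 0" by simp
    then show False by (auto simp: less_poly_mapping.rep_eq less_fun_def)
  qed
  then show ?thesis
    by (auto simp: monomial_order_def order_on_defs refl_on_def total_on_def add_right_mono
        intro!: transI antisymI)
qed

section \<open>Positive and negative parts\<close>

lemma lookup_pos_part [simp]: "Poly_Mapping.lookup (pos_part u) i = nat (u $ i)"
  by (simp add: pos_part_def)

lemma lookup_neg_part [simp]: "Poly_Mapping.lookup (neg_part u) i = nat (- (u $ i))"
  by (simp add: neg_part_def)

section \<open>Stretching vectors and exponents along a weighted surjection\<close>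

text \<open>
  In the application \<open>\<beta>\<close> sends a column to its bouquet, and \<open>d\<close> collects the entries of the
  vectors \<open>c\<^sub>B\<close> of the non-free bouquets and is \<open>1\<close> on the free one.
\<close>

locale stretching =
  fixes \<beta> :: "'n::finite \<Rightarrow> 's::finite" and d :: "'n \<Rightarrow> nat"
  assumes surj: "surj \<beta>" and pos: "0 < d i"
begin

definition stretch :: "int^'s \<Rightarrow> int^'n" where
  "stretch u = (\<chi> i. int (d i) * u $ \<beta> i)"

definition exp_stretch :: "'s pp \<Rightarrow> 'n pp" where
  "exp_stretch w = Abs_poly_mapping (\<lambda>i. d i * Poly_Mapping.lookup w (\<beta> i))"

lemma stretch_nth [simp]: "stretch u $ i = int (d i) * u $ \<beta> i"
  by (simp add: stretch_def)

lemma lookup_exp_stretch [simp]: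
  "Poly_Mapping.lookup (exp_stretch w) i = d i * Poly_Mapping.lookup w (\<beta> i)"
  by (simp add: exp_stretch_def)

lemma stretch_add: "stretch (u + v) = stretch u + stretch v"
  by (simp add: vec_eq_iff algebra_simps)

lemma stretch_minus: "stretch (- u) = - stretch u"
  by (simp add: vec_eq_iff)

lemma ex_preimage: "\<exists>i. \<beta> i = b"
  using surj by (metis surjD)

lemma stretch_inject [simp]: "stretch u = stretch v \<longleftrightarrow> u = v"
proof
  assume eq: "stretch u = stretch v"
  have "u $ b = v $ b" for b
  proof -
    obtain i where i: "\<beta> i = b" using ex_preimage by blast
    have "stretch u $ i = stretch v $ i" using eq by simp
    then show ?thesis using i pos[of i] by simp
  qed
  then show "u = v" by (simp add: vec_eq_iff)
qed simp

lemma inj_stretch: "inj stretch"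
  by (rule injI) simp

lemma stretch_eq_0 [simp]: "stretch u = 0 \<longleftrightarrow> u = 0"
proof -
  have "stretch 0 = 0" by (simp add: vec_eq_iff)
  then show ?thesis by (metis stretch_inject)
qed

lemma exp_stretch_inject [simp]: "exp_stretch v = exp_stretch w \<longleftrightarrow> v = w"
proof
  assume eq: "exp_stretch v = exp_stretch w"
  show "v = w"
  proof (rule poly_mapping_eqI)
    fix b
    obtain i where i: "\<beta> i = b" using ex_preimage by blast
    have "Poly_Mapping.lookup (exp_stretch v) i = Poly_Mapping.lookup (exp_stretch w) i"
      using eq by simp
    then show "Poly_Mapping.lookup v b = Poly_Mapping.lookup w b"
      using i pos[of i] by simp
  qed
qed simp

lemma exp_stretch_zero [simp]: "exp_stretch 0 = 0"
  by (rule poly_mapping_eqI) simp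

lemma exp_stretch_add: "exp_stretch (v + w) = exp_stretch v + exp_stretch w"
  by (rule poly_mapping_eqI) (simp add: lookup_add algebra_simps)

lemma pos_part_stretch: "pos_part (stretch u) = exp_stretch (pos_part u)"
  by (rule poly_mapping_eqI) (simp add: nat_mult_distrib)

lemma neg_part_stretch: "neg_part (stretch u) = exp_stretch (neg_part u)"
proof (rule poly_mapping_eqI)
  fix i
  have "nat (- (int (d i) * u $ \<beta> i)) = nat (int (d i) * (- (u $ \<beta> i)))" by simp
  also have "\<dots> = d i * nat (- (u $ \<beta> i))" by (subst nat_mult_distrib) auto
  finally show "Poly_Mapping.lookup (neg_part (stretch u)) i
      = Poly_Mapping.lookup (exp_stretch (neg_part u)) i" by simp
qed

section \<open>The induced embedding of polynomial rings\<close>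

text \<open>
  The \<open>K\<close>-algebra homomorphism with \<open>y\<^sub>b \<mapsto> \<Prod>\<^bsub>\<beta>(i) = b\<^esub> x\<^sub>i\<^bsup>d(i)\<^esup>\<close>.
\<close>

definition poly_stretch :: "('s, 'k::field) mpoly \<Rightarrow> ('n, 'k) mpoly" where
  "poly_stretch f = (\<Sum>w\<in>Poly_Mapping.keys f. Poly_Mapping.single (exp_stretch w) (Poly_Mapping.lookup f w))"

lemma poly_stretch_add: "poly_stretch (f + g) = poly_stretch f + poly_stretch g"
  unfolding poly_stretch_def by (rule setsum_keys_plus_distrib) (simp_all add: single_add)

lemma poly_stretch_zero [simp]: "poly_stretch 0 = 0"
  by (simp add: poly_stretch_def)

lemma poly_stretch_single [simp]:
  "poly_stretch (Poly_Mapping.single w a) = Poly_Mapping.single (exp_stretch w) a"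
  by (simp add: poly_stretch_def)

lemma poly_stretch_diff: "poly_stretch (f - g) = poly_stretch f - poly_stretch g"
  using poly_stretch_add[of "f - g" g] by (simp add: algebra_simps)

lemma poly_stretch_mult: "poly_stretch (f * g) = poly_stretch f * poly_stretch g"
proof (induction f rule: mpoly_induct_add)
  case (single t a)
  show ?case
    by (induction g rule: mpoly_induct_add)
      (simp_all add: mult_single exp_stretch_add distrib_left poly_stretch_add)
qed (simp_all add: distrib_right poly_stretch_add)

lemma poly_stretch_binom: "poly_stretch (binom u) = binom (stretch u)"
  by (simp add: binom_def poly_stretch_diff pos_part_stretch neg_part_stretch)

lemma image_binom_stretch: "binom ` stretch ` U = poly_stretch ` binom ` U"
  by (simp add: image_image poly_stretch_binom)

section \<open>Coordinates over the smaller polynomial ring\<close>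

text \<open>
  If \<open>x\<^sup>e\<close> is one of the basis monomials of \<open>K[x]\<close> over \<open>K[y]\<close>, this is the coefficient of \<open>x\<^sup>e\<close>.
\<close>

definition slice :: "'n pp \<Rightarrow> ('n, 'k::field) mpoly \<Rightarrow> ('s, 'k) mpoly" where
  "slice e = Poly_Mapping.map_key (\<lambda>w. e + exp_stretch w)"

text \<open>
  No image of a variable \<open>y\<^sub>b\<close> divides \<open>x\<^sup>e\<close>: these are the basis monomials of \<open>K[x]\<close> over \<open>K[y]\<close>.
\<close>

definition reduced :: "'n pp \<Rightarrow> bool" where
  "reduced e \<longleftrightarrow> (\<forall>b. \<exists>i. \<beta> i = b \<and> Poly_Mapping.lookup e i < d i)"

lemma inj_shift: "inj (\<lambda>w. e + exp_stretch w)"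
  by (rule injI) simp

lemma lookup_slice [simp]: "Poly_Mapping.lookup (slice e f) w = Poly_Mapping.lookup f (e + exp_stretch w)"
  unfolding slice_def by (simp add: map_key.rep_eq[OF inj_shift])

lemma keys_slice: "w \<in> Poly_Mapping.keys (slice e f) \<longleftrightarrow> e + exp_stretch w \<in> Poly_Mapping.keys f"
  by (simp add: in_keys_iff)

lemma slice_add: "slice e (f + g) = slice e f + slice e g"
  by (rule poly_mapping_eqI) (simp add: lookup_add)

lemma slice_zero [simp]: "slice e 0 = 0"
  by (rule poly_mapping_eqI) simp

lemma reduced_zero: "reduced 0"
  using ex_preimage pos by (auto simp: reduced_def)

text \<open>
  On each fibre some coordinate of \<open>e\<close> is less than the weight, and there the exponent on the
  right is too small to contain more copies of the weight than \<open>v\<close> provides; so \<open>w \<le> v\<close>.  This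
  says that the span of the monomials in \<open>x\<^sup>e K[y]\<close> has a \<open>K[y]\<close>-stable complement.
\<close>

lemma reduced_cancel:
  assumes "reduced e" and eq: "t + exp_stretch w = e + exp_stretch v"
  shows "\<exists>v'. t = e + exp_stretch v' \<and> v = v' + w"
proof -
  have le: "Poly_Mapping.lookup w b \<le> Poly_Mapping.lookup v b" for b
  proof (rule ccontr)
    assume "\<not> ?thesis"
    then have lt: "Suc (Poly_Mapping.lookup v b) \<le> Poly_Mapping.lookup w b" by simp
    obtain i where i: "\<beta> i = b" "Poly_Mapping.lookup e i < d i"
      using assms(1) by (auto simp: reduced_def)
    have "Poly_Mapping.lookup (t + exp_stretch w) i = Poly_Mapping.lookup (e + exp_stretch v) i"
      using eq by simp
    then have "Poly_Mapping.lookup t i + d i * Poly_Mapping.lookup w b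
        = Poly_Mapping.lookup e i + d i * Poly_Mapping.lookup v b"
      using i by (simp add: lookup_add)
    moreover have "d i * Suc (Poly_Mapping.lookup v b) \<le> d i * Poly_Mapping.lookup w b"
      using lt by (rule mult_le_mono2)
    ultimately show False using i(2) by simp
  qed
  have v: "v = (v - w) + w"
    using le by (intro poly_mapping_eqI) (simp add: lookup_add lookup_minus)
  then have "t + exp_stretch w = (e + exp_stretch (v - w)) + exp_stretch w"
    using eq by (metis exp_stretch_add add.assoc)
  then have "t = e + exp_stretch (v - w)" by simp
  with v show ?thesis by blast
qed

text \<open>
  Division with remainder: take out the image of \<open>y\<^sub>b\<close> as often as all the coordinates in the
  fibre of \<open>b\<close> permit; a coordinate attaining the minimal quotient is left with its remainder.
\<close>

lemma ex_reduced:
  obtains e w where "reduced e" and "t = e + exp_stretch w"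
proof -
  define q where "q i = Poly_Mapping.lookup t i div d i" for i
  define w where "w = Abs_poly_mapping (\<lambda>b. Min (q ` {i. \<beta> i = b}))"
  have lw: "Poly_Mapping.lookup w b = Min (q ` {i. \<beta> i = b})" for b
    by (simp add: w_def)
  have le: "Poly_Mapping.lookup (exp_stretch w) i \<le> Poly_Mapping.lookup t i" for i
  proof -
    have "Poly_Mapping.lookup w (\<beta> i) \<le> q i" unfolding lw by (rule Min_le) auto
    then have "d i * Poly_Mapping.lookup w (\<beta> i) \<le> d i * q i" by (rule mult_le_mono2)
    also have "\<dots> \<le> Poly_Mapping.lookup t i" by (simp add: q_def)
    finally show ?thesis by simp
  qed
  have "t = (t - exp_stretch w) + exp_stretch w"
    using le by (intro poly_mapping_eqI) (simp only: lookup_add lookup_minus le_add_diff_inverse2)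
  moreover have "reduced (t - exp_stretch w)"
    unfolding reduced_def
  proof
    fix b
    have "Min (q ` {i. \<beta> i = b}) \<in> q ` {i. \<beta> i = b}"
      using ex_preimage by (intro Min_in) auto
    then obtain i where i: "\<beta> i = b" "Poly_Mapping.lookup w b = q i" unfolding lw by auto
    have "Poly_Mapping.lookup (t - exp_stretch w) i = Poly_Mapping.lookup t i mod d i"
      using i by (simp add: lookup_minus q_def minus_mult_div_eq_mod)
    then show "\<exists>i. \<beta> i = b \<and> Poly_Mapping.lookup (t - exp_stretch w) i < d i"
      using i pos[of i] by auto
  qed
  ultimately show thesis using that by blast
qed

text \<open>
  Slices are \<open>K[y]\<close>-linear.  Both sides are additive in \<open>p\<close> and \<open>g\<close>, so it is enough to compare
  them on monomials, where the claim is \<open>reduced_cancel\<close>.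
\<close>

lemma slice_mult:
  assumes "reduced e"
  shows "slice e (p * poly_stretch g) = slice e p * g"
proof (induction p rule: mpoly_induct_add)
  case (single t a)
  show ?case
  proof (induction g rule: mpoly_induct_add)
    case (single w b)
    show ?case
    proof (cases "\<exists>v. t = e + exp_stretch v")
      case True
      then obtain v where t: "t = e + exp_stretch v" by blast
      have 1: "slice e (Poly_Mapping.single (e + exp_stretch v) x) = Poly_Mapping.single v x" for v and x :: 'a
        by (rule poly_mapping_eqI) (simp add: lookup_single)
      have "slice e (Poly_Mapping.single t a * poly_stretch (Poly_Mapping.single w b))
          = slice e (Poly_Mapping.single (e + exp_stretch (v + w)) (a * b))"
        by (simp add: t mult_single exp_stretch_add add.assoc)
      also have "\<dots> = Poly_Mapping.single v a * Poly_Mapping.single w b" by (simp add: 1 mult_single)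
      finally show ?thesis by (simp only: t 1)
    next
      case False
      then have "slice e (Poly_Mapping.single t a) = 0"
        by (intro poly_mapping_eqI) (auto simp: lookup_single when_def)
      moreover have "slice e (Poly_Mapping.single (t + exp_stretch w) (a * b)) = 0"
        using False reduced_cancel[OF assms, of t w]
        by (intro poly_mapping_eqI) (auto simp: lookup_single when_def)
      ultimately show ?thesis by (simp add: mult_single)
    qed
  qed (simp_all add: distrib_left slice_add poly_stretch_add)
qed (simp_all add: distrib_right slice_add)

lemma slice_poly_stretch:
  fixes g :: "('s, 'k::field) mpoly"
  shows "slice 0 (poly_stretch g) = g"
proof -
  have "slice 0 (1 :: ('n, 'k) mpoly) = (1 :: ('s, 'k) mpoly)"
  proof (rule poly_mapping_eqI)
    fix w
    have "(0 = exp_stretch w) = (0 = w)" by (metis exp_stretch_inject exp_stretch_zero)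
    then show "Poly_Mapping.lookup (slice 0 (1 :: ('n, 'k) mpoly)) w = Poly_Mapping.lookup (1 :: ('s, 'k) mpoly) w"
      by (simp add: lookup_one when_def)
  qed
  then show ?thesis using slice_mult[OF reduced_zero, of 1 g] by simp
qed

lemma poly_stretch_inject [simp]: "poly_stretch f = poly_stretch g \<longleftrightarrow> f = g"
  by (metis slice_poly_stretch)

lemma poly_stretch_eq_0 [simp]: "poly_stretch f = 0 \<longleftrightarrow> f = 0"
  by (metis poly_stretch_inject poly_stretch_zero)

lemma lookup_poly_stretch [simp]:
  "Poly_Mapping.lookup (poly_stretch f) (exp_stretch w) = Poly_Mapping.lookup f w"
  using lookup_slice[of 0 "poly_stretch f" w] by (simp add: slice_poly_stretch)

lemma keys_poly_stretch: "Poly_Mapping.keys (poly_stretch f) = exp_stretch ` Poly_Mapping.keys f"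
proof
  have "Poly_Mapping.keys (poly_stretch f)
      \<subseteq> (\<Union>w\<in>Poly_Mapping.keys f. Poly_Mapping.keys (Poly_Mapping.single (exp_stretch w) (Poly_Mapping.lookup f w)))"
    unfolding poly_stretch_def by (rule keys_sum)
  also have "\<dots> \<subseteq> exp_stretch ` Poly_Mapping.keys f" by auto
  finally show "Poly_Mapping.keys (poly_stretch f) \<subseteq> exp_stretch ` Poly_Mapping.keys f" .
  show "exp_stretch ` Poly_Mapping.keys f \<subseteq> Poly_Mapping.keys (poly_stretch f)"
    by (auto simp: in_keys_iff)
qed

lemma poly_stretch_ideal_gen:
  "f \<in> ideal_gen F \<Longrightarrow> poly_stretch f \<in> ideal_gen (poly_stretch ` F)"
proof (induction rule: ideal_gen_induct)
  case zero
  show ?case by (simp add: ideal_gen_zero)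
next
  case (step p x y)
  then show ?case
    by (simp add: poly_stretch_add poly_stretch_mult ideal_gen_add ideal_gen_mult ideal_gen_base)
qed

lemma slice_ideal_gen:
  assumes "reduced e" and "f \<in> ideal_gen (poly_stretch ` F)"
  shows "slice e f \<in> ideal_gen F"
  using assms(2)
proof (induction rule: ideal_gen_induct)
  case zero
  show ?case by (simp add: ideal_gen_zero)
next
  case (step p x y)
  then obtain g where g: "g \<in> F" "x = poly_stretch g" by blast
  show ?case
    using step.IH ideal_gen_mult[OF ideal_gen_base[OF g(1)]]
    by (simp add: g(2) slice_add slice_mult[OF assms(1)] ideal_gen_add)
qed

text \<open>
  Contraction undoes extension of ideals, because the slice at \<open>0\<close> is a linear retraction.
\<close>

lemma poly_stretch_in_ideal_gen_iff:
  "poly_stretch f \<in> ideal_gen (poly_stretch ` F) \<longleftrightarrow> f \<in> ideal_gen F"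
  using slice_ideal_gen[OF reduced_zero, of "poly_stretch f" F] poly_stretch_ideal_gen[of f F]
  by (auto simp: slice_poly_stretch)

lemma ideal_gen_stretch_subset_iff:
  "ideal_gen (poly_stretch ` F) \<subseteq> ideal_gen (poly_stretch ` G) \<longleftrightarrow> ideal_gen F \<subseteq> ideal_gen G"
  unfolding ideal_gen_subset_iff by (auto simp: poly_stretch_in_ideal_gen_iff)

lemma ideal_gen_stretch_eq_iff:
  "ideal_gen (poly_stretch ` F) = ideal_gen (poly_stretch ` G) \<longleftrightarrow> ideal_gen F = ideal_gen G"
  using ideal_gen_stretch_subset_iff by (metis subset_antisym order_refl)

section \<open>Restricting and extending monomial orders\<close>

definition extends_order :: "('s pp \<times> 's pp) set \<Rightarrow> ('n pp \<times> 'n pp) set \<Rightarrow> bool" where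
  "extends_order r' r \<longleftrightarrow> (\<forall>v w. (exp_stretch v, exp_stretch w) \<in> r \<longleftrightarrow> (v, w) \<in> r')"

text \<open>
  Monomial orders are cancellative because they are total.
\<close>

lemma monomial_order_shift:
  assumes "monomial_order r" and "(e + s, e + t) \<in> r"
  shows "(s, t) \<in> r"
proof (rule ccontr)
  assume n: "(s, t) \<notin> r"
  have lin: "linear_order r" using assms(1) by (simp add: monomial_order_def)
  then have "(s, s) \<in> r" by (auto simp: order_on_defs refl_on_def)
  with n have "s \<noteq> t" by auto
  then have "(t, s) \<in> r" using lin n by (auto simp: order_on_defs total_on_def)
  then have "(t + e, s + e) \<in> r" using assms(1) unfolding monomial_order_def by blast
  then have "(e + t, e + s) \<in> r" by (simp add: add.commute)
  then have "e + t = e + s" using lin assms(2) by (auto simp: order_on_defs dest: antisymD)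
  then show False using \<open>s \<noteq> t\<close> by simp
qed

lemma restricted_order:
  assumes "monomial_order r"
  shows "\<exists>r'. monomial_order r' \<and> extends_order r' r"
proof (intro exI conjI)
  let ?r = "{(v, w). (exp_stretch v, exp_stretch w) \<in> r}"
  show "extends_order ?r r" by (simp add: extends_order_def)
  have lin: "refl r" "trans r" "antisym r" "total r"
    using assms by (auto simp: monomial_order_def order_on_defs)
  have 0: "(0, t) \<in> r" and add: "(s, t) \<in> r \<Longrightarrow> (s + u, t + u) \<in> r" for s t u
    using assms by (auto simp: monomial_order_def)
  have "refl ?r" "trans ?r" "antisym ?r" "total ?r"
    subgoal using lin by (auto simp: refl_on_def)
    subgoal by (rule transI) (use lin in \<open>auto dest: transD\<close>)
    subgoal by (rule antisymI) (use lin in \<open>auto dest: antisymD\<close>)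
    subgoal using lin(4) by (auto simp: total_on_def)
    done
  then show "monomial_order ?r"
    using 0 add by (auto simp: monomial_order_def order_on_defs exp_stretch_add)
qed

text \<open>
  Choose a column in each fibre and map \<open>N\<^sup>n\<close> to \<open>N\<^sup>s\<close> by reading off the chosen coordinates,
  rescaled so that the composition with stretching of exponents is multiplication by one common
  factor \<open>P\<close>.  Compare the images under this map by the given order and break ties by any monomial
  order on \<open>N\<^sup>n\<close>.  On stretched exponents there are no ties, and multiplication by \<open>P > 0\<close>
  preserves and reflects the given order.
\<close>

lemma extended_order:
  assumes r': "monomial_order r'" and r0: "monomial_order (r0 :: ('n pp \<times> 'n pp) set)"
  shows "\<exists>r. monomial_order r \<and> extends_order r' r"
proof (intro exI conjI)
  define rep where "rep b = (SOME i. \<beta> i = b)" for b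
  have rep: "\<beta> (rep b) = b" for b unfolding rep_def by (rule someI_ex) (rule ex_preimage)
  \<comment> \<open>The weights of the chosen columns differ, so a common multiple is needed as scaling factor.\<close>
  define P where "P = (\<Prod>i\<in>UNIV. d i)"
  have P: "P > 0" unfolding P_def using pos by (simp add: prod_pos)
  have dP: "d i * (P div d i) = P" for i
    unfolding P_def by (rule dvd_mult_div_cancel) (rule dvd_prodI, auto)
  define \<pi> where "\<pi> t = Abs_poly_mapping (\<lambda>b. Poly_Mapping.lookup t (rep b) * (P div d (rep b)))" for t :: "'n pp"
  have lp: "Poly_Mapping.lookup (\<pi> t) b = Poly_Mapping.lookup t (rep b) * (P div d (rep b))" for t b
    by (simp add: \<pi>_def)
  have padd: "\<pi> (s + t) = \<pi> s + \<pi> t" for s t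
    by (rule poly_mapping_eqI) (simp add: lp lookup_add algebra_simps)
  have p0: "\<pi> 0 = 0" by (rule poly_mapping_eqI) (simp add: lp)
  define r where "r = {(s, t). (\<pi> s, \<pi> t) \<in> r' \<and> (\<pi> s = \<pi> t \<longrightarrow> (s, t) \<in> r0)}"
  have lin: "refl r'" "trans r'" "antisym r'" "total r'"
    using r' by (auto simp: monomial_order_def order_on_defs)
  have z: "(0, t) \<in> r'" and add: "(s, t) \<in> r' \<Longrightarrow> (s + u, t + u) \<in> r'" for s t u
    using r' by (auto simp: monomial_order_def)
  have lin0: "refl r0" "trans r0" "antisym r0" "total r0"
    using r0 by (auto simp: monomial_order_def order_on_defs)
  have z0: "(0, t) \<in> r0" and add0: "(s, t) \<in> r0 \<Longrightarrow> (s + u, t + u) \<in> r0" for s t u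
    using r0 by (auto simp: monomial_order_def)
  have "refl r" using lin(1) lin0(1) by (auto simp: refl_on_def r_def)
  moreover have "trans r"
  proof (rule transI)
    fix s t u assume st: "(s, t) \<in> r" and tu: "(t, u) \<in> r"
    then have a: "(\<pi> s, \<pi> t) \<in> r'" "(\<pi> t, \<pi> u) \<in> r'" by (auto simp: r_def)
    have "\<pi> s = \<pi> t \<and> \<pi> t = \<pi> u" if "\<pi> s = \<pi> u"
      using antisymD[OF lin(3), of "\<pi> s" "\<pi> t"] a that by auto
    then show "(s, u) \<in> r" using transD[OF lin(2) a] transD[OF lin0(2), of s t u] st tu unfolding r_def by auto
  qed
  moreover have "antisym r"
  proof (rule antisymI)
    fix s t assume "(s, t) \<in> r" "(t, s) \<in> r"
    then show "s = t" using antisymD[OF lin(3), of "\<pi> s" "\<pi> t"] antisymD[OF lin0(3), of s t] by (auto simp: r_def)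
  qed
  moreover have "total r"
  proof (rule total_onI)
    fix s t :: "'n pp" assume "s \<noteq> t"
    then have 0: "(s, t) \<in> r0 \<or> (t, s) \<in> r0" using lin0(4) by (simp add: total_on_def)
    show "(s, t) \<in> r \<or> (t, s) \<in> r"
    proof (cases "\<pi> s = \<pi> t")
      case True
      then show ?thesis using 0 lin(1) by (auto simp: r_def refl_on_def)
    next
      case False
      then have "(\<pi> s, \<pi> t) \<in> r' \<or> (\<pi> t, \<pi> s) \<in> r'" using lin(4) by (simp add: total_on_def)
      with False show ?thesis by (auto simp: r_def)
    qed
  qed
  moreover have "(s + u, t + u) \<in> r" if "(s, t) \<in> r" for s t u
    using that add by (auto simp: r_def padd add0)
  moreover have "(0, t) \<in> r" for t using z z0 by (simp add: r_def p0)
  ultimately show "monomial_order r" by (auto simp: monomial_order_def order_on_defs)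
  have pe: "Poly_Mapping.lookup (\<pi> (exp_stretch w)) b = P * Poly_Mapping.lookup w b" for w b
  proof -
    have "Poly_Mapping.lookup (\<pi> (exp_stretch w)) b
        = (d (rep b) * (P div d (rep b))) * Poly_Mapping.lookup w b"
      by (simp add: lp rep)
    then show ?thesis by (simp only: dP)
  qed
  have inj: "\<pi> (exp_stretch v) = \<pi> (exp_stretch w) \<longleftrightarrow> v = w" for v w
  proof
    assume "\<pi> (exp_stretch v) = \<pi> (exp_stretch w)"
    then have "P * Poly_Mapping.lookup v b = P * Poly_Mapping.lookup w b" for b using pe by metis
    then show "v = w" using P by (intro poly_mapping_eqI) simp
  qed simp
  define M where "M m w = Abs_poly_mapping (\<lambda>b. m * Poly_Mapping.lookup w b)" for m and w :: "'s pp"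
  have lM: "Poly_Mapping.lookup (M m w) b = m * Poly_Mapping.lookup w b" for m w b
    by (simp add: M_def)
  have M: "M 0 w = 0" "M (Suc m) w = w + M m w" for m w
    by (rule poly_mapping_eqI, simp add: lM lookup_add)+
  have scaled: "(M m v, M m w) \<in> r'" if "(v, w) \<in> r'" for m v w
  proof (induction m)
    case 0
    show ?case using lin(1) by (auto simp: M refl_on_def)
  next
    case (Suc m)
    have "(v + M m v, w + M m v) \<in> r'" "(M m v + w, M m w + w) \<in> r'" using that Suc add by auto
    then show ?case using transD[OF lin(2)] by (metis M(2) add.commute)
  qed
  have piM: "\<pi> (exp_stretch w) = M P w" for w
    by (rule poly_mapping_eqI) (simp add: pe lM)
  have mono: "(v, w) \<in> r' \<Longrightarrow> (exp_stretch v, exp_stretch w) \<in> r" for v w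
    using scaled[of v w P] lin0(1) by (auto simp: r_def inj refl_on_def simp flip: piM)
  show "extends_order r' r"
    unfolding extends_order_def
  proof (intro allI iffI)
    fix v w assume vw: "(exp_stretch v, exp_stretch w) \<in> r"
    show "(v, w) \<in> r'"
    proof (rule ccontr)
      assume n: "(v, w) \<notin> r'"
      then have "v \<noteq> w" using lin(1) by (auto simp: refl_on_def)
      then have "(w, v) \<in> r'" using n lin(4) by (auto simp: total_on_def)
      then have "exp_stretch v = exp_stretch w"
        using mono antisymD[OF \<open>antisym r\<close>] vw by blast
      then show False using \<open>v \<noteq> w\<close> by simp
    qed
  qed (fact mono)
qed

section \<open>Initial ideals and reduced Groebner bases\<close>

context
  fixes r' r
  assumes r': "monomial_order r'" and r: "monomial_order r" and ext: "extends_order r' r"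
begin

lemma lin: "linear_order r'" "linear_order r"
  using r' r by (auto simp: monomial_order_def)

lemma lead_exp_stretch:
  assumes "f \<noteq> 0"
  shows "lead_exp r (poly_stretch f) = exp_stretch (lead_exp r' f)"
  using lead_exp_max[OF lin(1) assms] ext
  by (intro lead_exp_eqI[OF lin(2)]) (auto simp: keys_poly_stretch extends_order_def)

lemma lead_coef_stretch: "lead_coef r (poly_stretch f) = lead_coef r' f"
  by (cases "f = 0") (simp_all add: lead_coef_def lead_exp_stretch)

lemma lead_term_stretch: "lead_term r (poly_stretch f) = poly_stretch (lead_term r' f)"
  by (cases "f = 0") (simp_all add: lead_term_def lead_coef_stretch lead_exp_stretch, simp add: lead_coef_def)

text \<open>
  Inside \<open>e + exp_stretch w\<close> with \<open>e\<close> fixed, the order on \<open>K[x]\<close> is the order on \<open>K[y]\<close>; so the slice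
  that meets the leading monomial keeps it as its own leading monomial.
\<close>

lemma lead_exp_slice:
  assumes "f \<noteq> 0" and "lead_exp r f = e + exp_stretch w"
  shows "slice e f \<noteq> 0" and "lead_exp r' (slice e f) = w"
proof -
  have w: "w \<in> Poly_Mapping.keys (slice e f)"
    using lead_exp_max(1)[OF lin(2) assms(1)] assms(2) by (simp add: keys_slice)
  then show "slice e f \<noteq> 0" by auto
  show "lead_exp r' (slice e f) = w"
  proof (rule lead_exp_eqI[OF lin(1) w])
    fix v assume "v \<in> Poly_Mapping.keys (slice e f)"
    then have "(e + exp_stretch v, e + exp_stretch w) \<in> r"
      using lead_exp_max(2)[OF lin(2) assms(1), of "e + exp_stretch v"] assms(2) by (simp add: keys_slice)
    then have "(exp_stretch v, exp_stretch w) \<in> r" by (rule monomial_order_shift[OF r])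
    then show "(v, w) \<in> r'" using ext by (simp add: extends_order_def)
  qed
qed

text \<open>
  The leading term of \<open>f\<close> is \<open>x\<^sup>e\<close> times the image of the leading term of a slice of \<open>f\<close>, and that
  slice lies in the smaller ideal.
\<close>

lemma initial_ideal_stretch:
  "ideal_gen (lead_term r ` (ideal_gen (poly_stretch ` F) - {0}))
    = ideal_gen (poly_stretch ` lead_term r' ` (ideal_gen F - {0}))" (is "?L = ?R")
proof
  show "?R \<subseteq> ?L"
    by (rule ideal_gen_mono) (auto simp: lead_term_stretch[symmetric] poly_stretch_in_ideal_gen_iff)
  show "?L \<subseteq> ?R"
    unfolding ideal_gen_subset_iff
  proof
    fix x assume "x \<in> lead_term r ` (ideal_gen (poly_stretch ` F) - {0})"
    then obtain f where f: "f \<in> ideal_gen (poly_stretch ` F)" "f \<noteq> 0" "x = lead_term r f" by auto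
    obtain e w where e: "reduced e" and ew: "lead_exp r f = e + exp_stretch w" by (rule ex_reduced)
    note s = lead_exp_slice[OF f(2) ew]
    have "slice e f \<in> ideal_gen F - {0}" using slice_ideal_gen[OF e f(1)] s by simp
    then have "poly_stretch (lead_term r' (slice e f)) \<in> ?R"
      by (intro ideal_gen_base) auto
    moreover have "x = Poly_Mapping.single e 1 * poly_stretch (lead_term r' (slice e f))"
      using s ew f(3) by (simp add: lead_term_def lead_coef_def mult_single)
    ultimately show "x \<in> ?R" by (simp add: ideal_gen_mult)
  qed
qed

lemma lead_term_image_stretch:
  "lead_term r ` (poly_stretch ` G - {poly_stretch p}) = poly_stretch ` lead_term r' ` (G - {p})"
proof -
  have "poly_stretch ` G - {poly_stretch p} = poly_stretch ` (G - {p})" by auto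
  then show ?thesis by (simp add: image_image lead_term_stretch)
qed

lemma groebner_basis_stretch_iff:
  "groebner_basis r (ideal_gen (poly_stretch ` F)) (poly_stretch ` G) \<longleftrightarrow>
   groebner_basis r' (ideal_gen F) G"
proof -
  have "finite (poly_stretch ` G) \<longleftrightarrow> finite G"
    by (rule finite_image_iff) (simp add: inj_on_def)
  then show ?thesis
    unfolding groebner_basis_def initial_ideal_stretch
    using lead_term_image_stretch[of G 0]
    by (auto simp: ideal_gen_stretch_eq_iff poly_stretch_in_ideal_gen_iff)
qed

lemma reduced_groebner_basis_stretch_iff:
  "reduced_groebner_basis r (ideal_gen (poly_stretch ` F)) (poly_stretch ` G) \<longleftrightarrow>
   reduced_groebner_basis r' (ideal_gen F) G"
proof -
  have "Poly_Mapping.single (exp_stretch t) 1 \<in> ideal_gen (poly_stretch ` lead_term r' ` (G - {p}))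
      \<longleftrightarrow> Poly_Mapping.single t 1 \<in> ideal_gen (lead_term r' ` (G - {p}))" for t p
    using poly_stretch_in_ideal_gen_iff[of "Poly_Mapping.single t 1"] by simp
  then show ?thesis
    unfolding reduced_groebner_basis_def groebner_basis_stretch_iff
    by (simp add: lead_coef_stretch lead_term_image_stretch keys_poly_stretch)
qed

end

end

section \<open>Matrices whose kernels correspond under stretching\<close>

locale kernel_stretching = stretching \<beta> d
  for \<beta> :: "'n::finite \<Rightarrow> 's::finite" and d :: "'n \<Rightarrow> nat" +
  fixes A :: "int^'n::finite^'m::finite" and A' :: "int^'s^'m"
  assumes stretch_ker_iff: "stretch u \<in> int_ker A \<longleftrightarrow> u \<in> int_ker A'"
    and ker_stretch: "int_ker A \<subseteq> range stretch"
    and Gcd_fibre: "Gcd (d ` {i. \<beta> i = b}) = 1"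
begin

lemma image_ker: "stretch ` int_ker A' = int_ker A"
  using stretch_ker_iff ker_stretch by auto

lemma bij_betw_stretchI:
  assumes "S' \<subseteq> int_ker A'" and "S \<subseteq> int_ker A"
    and "\<And>u. u \<in> int_ker A' \<Longrightarrow> stretch u \<in> S \<longleftrightarrow> u \<in> S'"
  shows "bij_betw stretch S' S"
proof -
  have "stretch ` S' = S"
  proof
    show "stretch ` S' \<subseteq> S" using assms(1,3) by blast
    show "S \<subseteq> stretch ` S'"
    proof
      fix v assume v: "v \<in> S"
      then obtain u where "u \<in> int_ker A'" "v = stretch u" using assms(2) image_ker by blast
      then show "v \<in> stretch ` S'" using assms(3) v by blast
    qed
  qed
  then show ?thesis using inj_on_subset[OF inj_stretch] by (auto simp: bij_betw_def)
qed

lemma bij_betw_image_stretchI: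
  assumes "\<And>U. U \<in> \<S>' \<Longrightarrow> U \<subseteq> int_ker A'" and "\<And>U. U \<in> \<S> \<Longrightarrow> U \<subseteq> int_ker A"
    and "\<And>U. U \<subseteq> int_ker A' \<Longrightarrow> stretch ` U \<in> \<S> \<longleftrightarrow> U \<in> \<S>'"
  shows "bij_betw (\<lambda>U. stretch ` U) \<S>' \<S>"
proof -
  have "(\<lambda>U. stretch ` U) ` \<S>' = \<S>"
  proof
    show "(\<lambda>U. stretch ` U) ` \<S>' \<subseteq> \<S>" using assms by blast
    show "\<S> \<subseteq> (\<lambda>U. stretch ` U) ` \<S>'"
    proof
      fix U assume U: "U \<in> \<S>"
      then have "U \<subseteq> stretch ` int_ker A'" using assms(2) image_ker by simp
      then obtain U' where "U' \<subseteq> int_ker A'" "U = stretch ` U'" by (auto simp: subset_image_iff)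
      then show "U \<in> (\<lambda>U. stretch ` U) ` \<S>'" using assms(3) U by blast
    qed
  qed
  moreover have "inj_on (\<lambda>U. stretch ` U) \<S>'"
    by (rule inj_onI) (simp add: inj_image_eq_iff[OF inj_stretch])
  ultimately show ?thesis by (simp add: bij_betw_def)
qed

lemma bij_betw_int_ker: "bij_betw stretch (int_ker A') (int_ker A)"
  by (rule bij_betw_stretchI) (auto simp: stretch_ker_iff)

lemma bex_ker: "(\<exists>v\<in>int_ker A. P v) \<longleftrightarrow> (\<exists>v\<in>int_ker A'. P (stretch v))"
  by (simp flip: image_ker)

lemma graver_stretch_iff:
  "stretch u \<in> graver_basis A \<longleftrightarrow> u \<in> graver_basis A'"
  by (simp add: graver_basis_def stretch_ker_iff bex_ker pos_part_stretch neg_part_stretch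
      flip: stretch_add exp_stretch_add)

lemma bij_betw_graver: "bij_betw stretch (graver_basis A') (graver_basis A)"
  by (rule bij_betw_stretchI) (auto simp: graver_stretch_iff, auto simp: graver_basis_def)

lemma vsupp_stretch: "vsupp (stretch u) = \<beta> -` vsupp u"
  using pos by (auto simp: vsupp_def)

lemma vsupp_stretch_psubset: "vsupp (stretch v) \<subset> vsupp (stretch u) \<longleftrightarrow> vsupp v \<subset> vsupp u"
proof -
  have "\<beta> -` S \<subseteq> \<beta> -` T \<longleftrightarrow> S \<subseteq> T" for S T
    using surj by (metis vimage_mono surj_image_vimage_eq image_mono)
  then show ?thesis by (simp add: vsupp_stretch less_le_not_le)
qed

text \<open>
  A common divisor of the stretched vector divides \<open>d\<^sub>i u\<^sub>b\<close> for all \<open>i\<close> in the fibre of \<open>b\<close>,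
  hence divides \<open>u\<^sub>b\<close> times the gcd of these weights, which is \<open>1\<close>.
\<close>

lemma Gcd_range_stretch: "Gcd (range (\<lambda>i. stretch u $ i)) = Gcd (range (\<lambda>b. u $ b))"
proof (rule Gcd_eqI)
  fix x assume "x \<in> range (\<lambda>i. stretch u $ i)"
  then obtain i where "x = int (d i) * u $ \<beta> i" by auto
  then show "Gcd (range (\<lambda>b. u $ b)) dvd x" by (metis Gcd_dvd dvd_mult rangeI)
next
  fix c assume c: "\<And>x. x \<in> range (\<lambda>i. stretch u $ i) \<Longrightarrow> c dvd x"
  show "c dvd Gcd (range (\<lambda>b. u $ b))"
  proof (rule Gcd_greatest)
    fix x assume "x \<in> range (\<lambda>b. u $ b)"
    then obtain b where x: "x = u $ b" by auto
    have "nat \<bar>c\<bar> dvd Gcd ((*) (nat \<bar>x\<bar>) ` d ` {i. \<beta> i = b})"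
    proof (rule Gcd_greatest)
      fix y assume "y \<in> (*) (nat \<bar>x\<bar>) ` d ` {i. \<beta> i = b}"
      then obtain i where i: "\<beta> i = b" "y = nat \<bar>x\<bar> * d i" by auto
      have "c dvd int (d i) * x" using c[of "stretch u $ i"] i x by auto
      then have "nat \<bar>c\<bar> dvd nat \<bar>int (d i) * x\<bar>" by (simp add: nat_abs_dvd_iff)
      then show "nat \<bar>c\<bar> dvd y" by (simp add: i abs_mult nat_mult_distrib mult.commute)
    qed
    also have "Gcd ((*) (nat \<bar>x\<bar>) ` d ` {i. \<beta> i = b}) = nat \<bar>x\<bar>"
      by (simp add: Gcd_mult Gcd_fibre)
    finally show "c dvd x" by (simp add: nat_abs_dvd_iff)
  qed
qed simp

lemma circuits_stretch_iff: "stretch u \<in> circuits A \<longleftrightarrow> u \<in> circuits A'"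
  by (simp only: circuits_def mem_Collect_eq stretch_ker_iff bex_ker vsupp_stretch_psubset
      Gcd_range_stretch stretch_eq_0)

lemma bij_betw_circuits: "bij_betw stretch (circuits A') (circuits A)"
  by (rule bij_betw_stretchI) (auto simp: circuits_stretch_iff, auto simp: circuits_def)

lemma toric_ideal_stretch: "toric_ideal A = ideal_gen (poly_stretch ` binom ` int_ker A')"
  by (simp only: toric_ideal_def image_binom_stretch[symmetric] image_ker)

lemma markov_basis_stretch_iff:
  "markov_basis TYPE('k::field) A (stretch ` M) \<longleftrightarrow> markov_basis TYPE('k) A' M"
proof -
  have "finite (stretch ` M) \<longleftrightarrow> finite M"
    by (rule finite_image_iff) (simp add: inj_on_def)
  then show ?thesis
    by (auto simp: markov_basis_def toric_ideal_stretch toric_ideal_def[of A'] image_binom_stretch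
        ideal_gen_stretch_eq_iff stretch_ker_iff)
qed

lemma minimal_markov_stretch_iff:
  "stretch ` M \<in> minimal_markov_bases TYPE('k::field) A \<longleftrightarrow> M \<in> minimal_markov_bases TYPE('k) A'"
proof -
  have "(\<exists>N. N \<subset> stretch ` M \<and> markov_basis TYPE('k) A N)
      \<longleftrightarrow> (\<exists>M'. M' \<subset> M \<and> markov_basis TYPE('k) A' M')"
  proof
    assume "\<exists>N. N \<subset> stretch ` M \<and> markov_basis TYPE('k) A N"
    then obtain N where N: "N \<subset> stretch ` M" "markov_basis TYPE('k) A N" by blast
    then obtain M' where M': "M' \<subseteq> M" "N = stretch ` M'" by (auto simp: subset_image_iff psubset_eq)
    then have "M' \<subset> M" using N(1) by auto
    then show "\<exists>M'. M' \<subset> M \<and> markov_basis TYPE('k) A' M'"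
      using N(2) M'(2) markov_basis_stretch_iff by blast
  next
    assume "\<exists>M'. M' \<subset> M \<and> markov_basis TYPE('k) A' M'"
    then obtain M' where M': "M' \<subset> M" "markov_basis TYPE('k) A' M'" by blast
    then have "stretch ` M' \<subset> stretch ` M"
      by (simp add: psubset_eq inj_image_subset_iff[OF inj_stretch] inj_image_eq_iff[OF inj_stretch])
    then show "\<exists>N. N \<subset> stretch ` M \<and> markov_basis TYPE('k) A N"
      using M'(2) markov_basis_stretch_iff by blast
  qed
  then show ?thesis
    unfolding minimal_markov_bases_def mem_Collect_eq markov_basis_stretch_iff by (rule arg_cong)
qed

lemma bij_betw_minimal_markov:
  "bij_betw (\<lambda>M. stretch ` M) (minimal_markov_bases TYPE('k::field) A') (minimal_markov_bases TYPE('k) A)"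
  by (rule bij_betw_image_stretchI)
    (simp_all add: minimal_markov_stretch_iff, simp_all add: minimal_markov_bases_def markov_basis_def)

lemma indispensables_stretch_iff:
  "stretch u \<in> indispensables TYPE('k::field) A \<longleftrightarrow> u \<in> indispensables TYPE('k) A'"
proof -
  have im: "minimal_markov_bases TYPE('k) A = (\<lambda>M. stretch ` M) ` minimal_markov_bases TYPE('k) A'"
    using bij_betw_minimal_markov[where 'k = 'k] by (simp add: bij_betw_def)
  have "stretch u \<in> stretch ` M \<longleftrightarrow> u \<in> M" for u M
    by (rule inj_image_mem_iff[OF inj_stretch])
  then show ?thesis
    unfolding indispensables_def im by (simp add: stretch_ker_iff flip: stretch_minus)
qed

lemma bij_betw_indispensables:
  "bij_betw stretch (indispensables TYPE('k::field) A') (indispensables TYPE('k) A)"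
  by (rule bij_betw_stretchI) (auto simp: indispensables_stretch_iff, auto simp: indispensables_def)

lemma reduced_groebner_basis_binom_iff:
  assumes "monomial_order r'" and "monomial_order r" and "extends_order r' r"
  shows "reduced_groebner_basis r (toric_ideal A) (binom ` stretch ` U :: ('n, 'k::field) mpoly set) \<longleftrightarrow>
      reduced_groebner_basis r' (toric_ideal A') (binom ` U :: ('s, 'k) mpoly set)"
  by (simp only: toric_ideal_stretch toric_ideal_def[of A'] image_binom_stretch
      reduced_groebner_basis_stretch_iff[OF assms])

lemma lead_term_binom_iff:
  assumes "monomial_order r'" and "monomial_order r" and "extends_order r' r"
  shows "lead_term r (binom (stretch u) :: ('n, 'k::field) mpoly) = Poly_Mapping.single (pos_part (stretch u)) 1 \<longleftrightarrow>
      lead_term r' (binom u :: ('s, 'k) mpoly) = Poly_Mapping.single (pos_part u) 1"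
  by (simp only: poly_stretch_binom[symmetric] lead_term_stretch[OF assms] pos_part_stretch
      poly_stretch_single[symmetric] poly_stretch_inject)

lemma reduced_groebner_bases_stretch_iff:
  assumes r0: "monomial_order (r0 :: ('n pp \<times> 'n pp) set)"
  shows "stretch ` U \<in> reduced_groebner_bases TYPE('k::field) A \<longleftrightarrow> U \<in> reduced_groebner_bases TYPE('k) A'"
proof -
  have "(\<exists>r. monomial_order r \<and>
        reduced_groebner_basis r (toric_ideal A :: ('n, 'k) mpoly set) (binom ` stretch ` U) \<and>
        (\<forall>u \<in> U. lead_term r (binom (stretch u) :: ('n, 'k) mpoly) = Poly_Mapping.single (pos_part (stretch u)) 1)) \<longleftrightarrow>
      (\<exists>r'. monomial_order r' \<and>
        reduced_groebner_basis r' (toric_ideal A' :: ('s, 'k) mpoly set) (binom ` U) \<and>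
        (\<forall>u \<in> U. lead_term r' (binom u :: ('s, 'k) mpoly) = Poly_Mapping.single (pos_part u) 1))"
    (is "(\<exists>r. ?P r) \<longleftrightarrow> (\<exists>r'. ?Q r')")
  proof
    assume "\<exists>r. ?P r"
    then obtain r where r: "monomial_order r" "?P r" by blast
    obtain r' where r': "monomial_order r'" "extends_order r' r" using restricted_order[OF r(1)] by blast
    have "?Q r'"
      using r r' reduced_groebner_basis_binom_iff[OF r'(1) r(1) r'(2)] lead_term_binom_iff[OF r'(1) r(1) r'(2)]
      by blast
    then show "\<exists>r'. ?Q r'" ..
  next
    assume "\<exists>r'. ?Q r'"
    then obtain r' where r': "monomial_order r'" "?Q r'" by blast
    obtain r where r: "monomial_order r" "extends_order r' r" using extended_order[OF r'(1) r0] by blast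
    have "?P r"
      using r r' reduced_groebner_basis_binom_iff[OF r'(1) r(1) r(2)] lead_term_binom_iff[OF r'(1) r(1) r(2)]
      by blast
    then show "\<exists>r. ?P r" ..
  qed
  moreover have "stretch ` U \<subseteq> int_ker A \<longleftrightarrow> U \<subseteq> int_ker A'" using stretch_ker_iff by blast
  ultimately show ?thesis by (simp add: reduced_groebner_bases_def)
qed

lemma bij_betw_reduced_groebner_bases:
  assumes "monomial_order (r0 :: ('n pp \<times> 'n pp) set)"
  shows "bij_betw (\<lambda>U. stretch ` U) (reduced_groebner_bases TYPE('k::field) A') (reduced_groebner_bases TYPE('k) A)"
  by (rule bij_betw_image_stretchI)
    (simp_all add: reduced_groebner_bases_stretch_iff[OF assms], simp_all add: reduced_groebner_bases_def)

lemma bij_betw_universal_groebner_basis: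
  assumes "monomial_order (r0 :: ('n pp \<times> 'n pp) set)"
  shows "bij_betw stretch (universal_groebner_basis TYPE('k::field) A') (universal_groebner_basis TYPE('k) A)"
proof -
  have "reduced_groebner_bases TYPE('k) A = (\<lambda>U. stretch ` U) ` reduced_groebner_bases TYPE('k) A'"
    using bij_betw_reduced_groebner_bases[OF assms, where 'k = 'k] by (simp add: bij_betw_def)
  then have "universal_groebner_basis TYPE('k) A = stretch ` universal_groebner_basis TYPE('k) A'"
    unfolding universal_groebner_basis_def by auto
  then show ?thesis using inj_on_subset[OF inj_stretch] by (auto simp: bij_betw_def)
qed

end

section \<open>Bouquets of a stable toric ideal\<close>

lemma covector_orthogonal:
  assumes "covector A w" and "u \<in> int_ker A"
  shows "(\<Sum>i\<in>UNIV. w $ i * u $ i) = 0"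
proof -
  obtain v where w: "w = v v* A" using assms(1) by (auto simp: covector_def)
  have "(\<Sum>i\<in>UNIV. w $ i * u $ i) = (\<Sum>i\<in>UNIV. \<Sum>k\<in>UNIV. v $ k * (A $ k $ i * u $ i))"
    by (simp add: w vector_matrix_mult_def sum_distrib_left sum_distrib_right mult_ac)
  also have "\<dots> = (\<Sum>k\<in>UNIV. v $ k * (A *v u) $ k)"
    by (subst sum.swap) (simp add: matrix_vector_mult_def sum_distrib_left)
  also have "\<dots> = 0" using assms(2) by (simp add: int_ker_def)
  finally show ?thesis .
qed

lemma covector_orthogonal_vsupp:
  assumes "covector A w" and "u \<in> int_ker A"
  shows "(\<Sum>i\<in>vsupp w. w $ i * u $ i) = 0"
proof -
  have "(\<Sum>i\<in>vsupp w. w $ i * u $ i) = (\<Sum>i\<in>UNIV. w $ i * u $ i)"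
    by (rule sum.mono_neutral_left) (auto simp: vsupp_def)
  then show ?thesis using covector_orthogonal[OF assms] by simp
qed

lemma free_vector_ker:
  assumes "free_vector A i" and "u \<in> int_ker A"
  shows "u $ i = 0"
proof -
  obtain w where w: "covector A w" "vsupp w = {i}"
    using assms(1) by (auto simp: free_vector_def cocircuit_def)
  have "w $ i * u $ i = 0" using covector_orthogonal_vsupp[OF w(1) assms(2)] w(2) by simp
  moreover have "w $ i \<noteq> 0" using w(2) by (auto simp: vsupp_def)
  ultimately show ?thesis by simp
qed

text \<open>
  Orthogonality to a co-vector \<open>w\<close> supported on \<open>i\<close>, \<open>j\<close> says \<open>w\<^sub>i u\<^sub>i = - w\<^sub>j u\<^sub>j\<close>, and the two
  coefficients here have the same sign.
\<close>

lemma pos_edge_proportional: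
  assumes "{i, j} \<in> pos_edges A"
  shows "\<exists>p>0. \<exists>q>0. \<forall>u\<in>int_ker A. p * u $ i = q * u $ j"
proof -
  obtain i' j' w where ij: "{i, j} = {i', j'}" "i' \<noteq> j'" and w: "covector A w" "vsupp w = {i', j'}"
    and sgn: "sgn (w $ i') \<noteq> sgn (w $ j')"
    using assms by (auto simp: pos_edges_def cocircuit_def)
  have ij': "i \<noteq> j" "vsupp w = {i, j}" "sgn (w $ i) \<noteq> sgn (w $ j)"
    using ij w sgn by (auto simp: doubleton_eq_iff)
  have rel: "w $ i * u $ i + w $ j * u $ j = 0" if "u \<in> int_ker A" for u
    using covector_orthogonal_vsupp[OF w(1) that] ij' by simp
  have "w $ i \<noteq> 0" "w $ j \<noteq> 0" using ij'(2) by (auto simp: vsupp_def)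
  then consider "w $ i > 0" "w $ j < 0" | "w $ i < 0" "w $ j > 0"
    using ij'(3) by (cases "w $ i > 0"; cases "w $ j > 0") auto
  then show ?thesis
  proof cases
    case 1
    then show ?thesis
      by (intro exI[of _ "w $ i"] conjI exI[of _ "- w $ j"]) (use rel in \<open>auto simp: algebra_simps eq_neg_iff_add_eq_0\<close>)
  next
    case 2
    then show ?thesis
      by (intro exI[of _ "- w $ i"] conjI exI[of _ "w $ j"]) (use rel in \<open>auto simp: algebra_simps neg_eq_iff_add_eq_0\<close>)
  qed
qed

lemma equiv_bouquet: "equiv UNIV ({(i, j). {i, j} \<in> bouquet_edges A}\<^sup>*)"
proof (rule equivI)
  show "sym ({(i, j). {i, j} \<in> bouquet_edges A}\<^sup>*)"
    by (rule sym_rtrancl) (auto simp: sym_def insert_commute)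
qed (auto simp: refl_rtrancl trans_rtrancl)

text \<open>
  Columns of a bouquet are joined by a path of edges inside the bouquet.  In a non-mixed bouquet
  all of these lie in \<open>pos_edges\<close>, and the positive ratios multiply along the path.
\<close>

lemma non_mixed_proportional:
  assumes "non_mixed A B" and "i \<in> B" and "j \<in> B"
  shows "\<exists>p>0. \<exists>q>0. \<forall>u\<in>int_ker A. p * u $ i = q * u $ j"
proof -
  let ?R = "{(i, j). {i, j} \<in> bouquet_edges A}"
  have B: "B \<in> UNIV // ?R\<^sup>*"
    using assms(1) by (simp add: non_mixed_def nonfree_bouquet_def bouquets_def)
  have closed: "k \<in> B" if "(i, k) \<in> ?R\<^sup>*" for k
    using in_quotient_imp_closed[OF equiv_bouquet B assms(2)] that by blast
  have "(i, j) \<in> ?R\<^sup>*"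
    using in_quotient_imp_in_rel[OF equiv_bouquet B] assms(2,3) by blast
  then show ?thesis
  proof (induction rule: rtrancl_induct)
    case base
    show ?case by (intro exI[of _ 1] conjI ballI) simp_all
  next
    case (step j k)
    have jk: "j \<in> B" "k \<in> B"
      by (rule closed, fact step(1)) (rule closed, rule rtrancl_into_rtrancl[OF step(1,2)])
    have edge: "{j, k} \<in> bouquet_edges A" using step(2) by simp
    then have "j \<noteq> k" by (auto simp: bouquet_edges_def doubleton_eq_iff)
    with jk have "\<nexists>i. B = {i}" by blast
    then have "{j, k} \<in> pos_edges A"
      using assms(1) edge jk by (auto simp: non_mixed_def)
    then obtain p' q' where pq': "p' > 0" "q' > 0" "\<forall>u\<in>int_ker A. p' * u $ j = q' * u $ k"
      using pos_edge_proportional by blast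
    obtain p q where pq: "p > 0" "q > 0" "\<forall>u\<in>int_ker A. p * u $ i = q * u $ j"
      using step.IH by blast
    have "(p * p') * u $ i = (q * q') * u $ k" if "u \<in> int_ker A" for u
    proof -
      have "(p * p') * u $ i = p' * (p * u $ i)" by simp
      also have "\<dots> = q * (p' * u $ j)" using pq(3) that by simp
      also have "\<dots> = (q * q') * u $ k" using pq'(3) that by simp
      finally show ?thesis .
    qed
    then show ?case using pq(1,2) pq'(1,2) by (intro exI[of _ "p * p'"] conjI exI[of _ "q * q'"]) auto
  qed
qed

text \<open>
  A vector proportional to a primitive integer vector is an integer multiple of it: \<open>c\<^sub>k\<close> divides
  \<open>u\<^sub>k c\<^sub>j\<close> for all \<open>j\<close>, hence divides \<open>u\<^sub>k\<close> times the gcd of the \<open>c\<^sub>j\<close>.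
\<close>

lemma dvd_if_proportional:
  fixes c u :: "'n::finite \<Rightarrow> int"
  assumes proportional: "\<And>i j. i \<in> B \<Longrightarrow> j \<in> B \<Longrightarrow> u i * c j = u j * c i"
    and Gcd: "Gcd (c ` B) = 1" and nz: "\<And>i. i \<in> B \<Longrightarrow> c i \<noteq> 0"
  shows "\<exists>t. \<forall>i\<in>B. u i = t * c i"
proof (cases "B = {}")
  case False
  then obtain k where k: "k \<in> B" by blast
  have "c k dvd Gcd ((*) (u k) ` c ` B)"
  proof (rule Gcd_greatest)
    fix x assume "x \<in> (*) (u k) ` c ` B"
    then obtain j where "j \<in> B" "x = u k * c j" by auto
    then show "c k dvd x" using proportional[OF k, of j] by simp
  qed
  then have "c k dvd u k" by (simp add: Gcd_mult Gcd)
  then obtain t where t: "u k = c k * t" ..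
  have "u i = t * c i" if "i \<in> B" for i
  proof -
    have "u i * c k = (t * c i) * c k" using proportional[OF that k] t by simp
    then show ?thesis using nz[OF k] by simp
  qed
  then show ?thesis by blast
qed auto

text \<open>
  The vector \<open>c\<^sub>B\<close> is, up to a sign, the primitive part of the restriction to \<open>B\<close> of a member \<open>g\<close>
  of the lattice basis.  As \<open>g\<close> lies in the kernel, its entries on \<open>B\<close> have one common sign, and
  every other kernel vector is proportional to \<open>g\<close> on \<open>B\<close>.
\<close>

lemma bouquet_vector_non_mixed:
  fixes A :: "int^'n::{finite,linorder}^'m::finite"
  assumes Gs: "lattice_basis Gs (int_ker A)" and B: "non_mixed A B" and c: "bouquet_vector A Gs B c"
  shows "\<And>i. i \<in> B \<Longrightarrow> c $ i > 0"
    and "\<And>i. i \<notin> B \<Longrightarrow> c $ i = 0"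
    and "Gcd ((\<lambda>i. c $ i) ` B) = 1"
    and "\<And>u. u \<in> int_ker A \<Longrightarrow> \<exists>t. \<forall>i\<in>B. u $ i = t * c $ i"
proof -
  have "\<not> free_bouquet A B" and "B \<in> bouquets A"
    using B by (auto simp: non_mixed_def nonfree_bouquet_def)
  then have "B \<noteq> {}" using in_quotient_imp_non_empty[OF equiv_bouquet] unfolding bouquets_def by blast
  then have Min: "Min B \<in> B" by (intro Min_in) auto
  from c \<open>\<not> free_bouquet A B\<close> obtain j where j: "j < length Gs" "\<forall>i\<in>B. gale Gs i ! j \<noteq> 0"
    and c: "c = (\<chi> i. if i \<in> B
                  then (sgn (gale Gs (Min B) ! j) * (gale Gs i ! j))
                         div Gcd ((\<lambda>i. gale Gs i ! j) ` B)
                  else 0)"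
    by (auto simp: bouquet_vector_def)
  define g where "g = Gs ! j"
  have gale: "gale Gs i ! j = g $ i" for i using j(1) by (simp add: gale_def g_def)
  have nz: "g $ i \<noteq> 0" if "i \<in> B" for i using j(2) that gale by simp
  have "g \<in> set Gs" using j(1) by (simp add: g_def)
  then have g: "g \<in> int_ker A"
    using Gs module.span_base[OF module_int_vec] unfolding lattice_basis_def by blast
  define D where "D = Gcd ((\<lambda>i. g $ i) ` B)"
  have D: "D dvd g $ i" if "i \<in> B" for i unfolding D_def using that by (intro Gcd_dvd) auto
  have "D \<noteq> 0" using D[OF Min] nz[OF Min] by auto
  moreover have "D \<ge> 0" by (simp add: D_def)
  ultimately have "D > 0" by simp
  have sgn_g: "sgn (g $ Min B) * g $ i = \<bar>g $ i\<bar>" if iB: "i \<in> B" for i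
  proof -
    obtain p q where "p > 0" "q > 0" "\<forall>u\<in>int_ker A. p * u $ i = q * u $ Min B"
      using non_mixed_proportional[OF B iB Min] by blast
    then have "p * g $ i = q * g $ Min B" and pq: "p > 0" "q > 0" using g by auto
    then have "sgn (p * g $ i) = sgn (q * g $ Min B)" by simp
    then have "sgn (g $ i) = sgn (g $ Min B)" using pq by (simp add: sgn_mult)
    then show ?thesis by (metis abs_sgn mult.commute)
  qed
  have cD: "\<bar>g $ i\<bar> = D * c $ i" if "i \<in> B" for i
    using that D[OF that] by (simp add: c gale sgn_g flip: D_def)
  show pos: "c $ i > 0" if "i \<in> B" for i
    using cD[OF that] nz[OF that] \<open>D > 0\<close> by (metis zero_less_abs_iff zero_less_mult_pos)
  show "c $ i = 0" if "i \<notin> B" for i using that by (simp add: c)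
  show Gcd: "Gcd ((\<lambda>i. c $ i) ` B) = 1"
  proof -
    have "D * Gcd ((\<lambda>i. c $ i) ` B) dvd D"
    proof -
      have "D * Gcd ((\<lambda>i. c $ i) ` B) dvd Gcd ((\<lambda>i. g $ i) ` B)"
      proof (rule Gcd_greatest)
        fix x assume "x \<in> (\<lambda>i. g $ i) ` B"
        then obtain i where i: "i \<in> B" "x = g $ i" by auto
        have "D * Gcd ((\<lambda>i. c $ i) ` B) dvd D * c $ i"
          using i by (intro mult_dvd_mono Gcd_dvd) auto
        then show "D * Gcd ((\<lambda>i. c $ i) ` B) dvd x" using cD[OF i(1)] i(2) by (metis dvd_abs_iff)
      qed
      then show ?thesis by (simp add: D_def)
    qed
    then have "Gcd ((\<lambda>i. c $ i) ` B) dvd 1"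
      using \<open>D > 0\<close> by (metis dvd_mult_cancel_left mult.right_neutral less_irrefl)
    then show ?thesis by simp
  qed
  show "\<exists>t. \<forall>i\<in>B. u $ i = t * c $ i" if u: "u \<in> int_ker A" for u
  proof (rule dvd_if_proportional[OF _ Gcd])
    fix i k assume i: "i \<in> B" and k: "k \<in> B"
    obtain p q where pq: "p > 0" "q > 0" "\<forall>u\<in>int_ker A. p * u $ i = q * u $ k"
      using non_mixed_proportional[OF B i k] by blast
    have "p * u $ i = q * u $ k" "p * g $ i = q * g $ k" using pq(3) u g by auto
    moreover have "p * \<bar>g $ i\<bar> = q * \<bar>g $ k\<bar>"
      using \<open>p * g $ i = q * g $ k\<close> pq(1,2) by (metis abs_mult abs_of_pos)
    then have "D * (p * c $ i) = D * (q * c $ k)" using cD[OF i] cD[OF k] by (simp add: mult.left_commute)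
    then have "p * c $ i = q * c $ k" using \<open>D > 0\<close> by simp
    ultimately have "q * (u $ i * c $ k) = q * (u $ k * c $ i)"
      by (metis mult.left_commute mult.commute)
    then show "u $ i * c $ k = u $ k * c $ i" using pq(2) by simp
  qed (use pos in force)
qed

lemma bouquet_matrix_mult: "bouquet_matrix A c *v u = A *v bouquet_map c u"
proof -
  have "(bouquet_matrix A c *v u) $ k = (A *v bouquet_map c u) $ k" for k
  proof -
    have "(bouquet_matrix A c *v u) $ k = (\<Sum>b\<in>UNIV. \<Sum>i\<in>UNIV. A $ k $ i * (u $ b * c b $ i))"
      by (simp add: matrix_vector_mult_def bouquet_matrix_def bouquet_column_def column_def
          sum_distrib_left sum_distrib_right mult_ac)
    also have "\<dots> = (A *v bouquet_map c u) $ k"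
      by (subst sum.swap) (simp add: matrix_vector_mult_def bouquet_map_def sum_distrib_left)
    finally show ?thesis .
  qed
  then show ?thesis by (simp add: vec_eq_iff)
qed

theorem theoremC:
  fixes A :: "int^'n::{finite,linorder}^'m::finite"
    and Gs :: "(int^'n::{finite,linorder}) list"
    and Bq :: "'s::finite \<Rightarrow> 'n set"
    and c :: "'s \<Rightarrow> int^'n::{finite,linorder}"
  assumes "lattice_basis Gs (int_ker A)"
    and "bij_betw Bq UNIV (bouquets A)"
    and "\<And>b. bouquet_vector A Gs (Bq b) (c b)"
    and "stable_toric A"
  shows "bij_betw (bouquet_map c) (int_ker (bouquet_matrix A c)) (int_ker A) \<and>
     bij_betw (bouquet_map c) (graver_basis (bouquet_matrix A c)) (graver_basis A) \<and>
     bij_betw (bouquet_map c) (circuits (bouquet_matrix A c)) (circuits A) \<and>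
     bij_betw (bouquet_map c) (indispensables TYPE('k::field) (bouquet_matrix A c))
       (indispensables TYPE('k) A) \<and>
     bij_betw (\<lambda>M. bouquet_map c ` M) (minimal_markov_bases TYPE('k) (bouquet_matrix A c))
       (minimal_markov_bases TYPE('k) A) \<and>
     bij_betw (\<lambda>U. bouquet_map c ` U) (reduced_groebner_bases TYPE('k) (bouquet_matrix A c))
       (reduced_groebner_bases TYPE('k) A) \<and>
     bij_betw (bouquet_map c) (universal_groebner_basis TYPE('k) (bouquet_matrix A c))
       (universal_groebner_basis TYPE('k) A)"
proof -
  let ?A' = "bouquet_matrix A c"
  have part: "\<Union> (bouquets A) = UNIV"
    unfolding bouquets_def by (rule Union_quotient[OF equiv_bouquet])
  have disj: "B = B' \<or> B \<inter> B' = {}" if "B \<in> bouquets A" "B' \<in> bouquets A" for B B'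
    using that unfolding bouquets_def by (rule quotient_disj[OF equiv_bouquet])
  have nonempty: "B \<noteq> {}" if "B \<in> bouquets A" for B
    using that unfolding bouquets_def by (rule in_quotient_imp_non_empty[OF equiv_bouquet])
  have Bq: "Bq b \<in> bouquets A" for b using assms(2) by (auto simp: bij_betw_def)
  define \<beta> where "\<beta> i = (THE b. i \<in> Bq b)" for i
  have uniq: "\<exists>!b. i \<in> Bq b" for i
  proof -
    have "i \<in> \<Union> (Bq ` UNIV)" using part assms(2) by (simp add: bij_betw_def)
    then obtain b where "i \<in> Bq b" by blast
    moreover have "b' = b" if "i \<in> Bq b'" for b'
      using disj[OF Bq Bq, of b b'] that \<open>i \<in> Bq b\<close> assms(2) by (auto simp: bij_betw_def inj_def)
    ultimately show ?thesis by blast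
  qed
  have \<beta>: "\<beta> i = b \<longleftrightarrow> i \<in> Bq b" for i b
    unfolding \<beta>_def using theI'[OF uniq[of i]] uniq[of i] by blast
  have fibre: "{i. \<beta> i = b} = Bq b" for b by (simp add: \<beta>)
  define free where "free b \<longleftrightarrow> free_bouquet A (Bq b)" for b
  have nonmixed: "non_mixed A (Bq b)" if "\<not> free b" for b
    using assms(4) Bq that by (simp add: stable_toric_def nonfree_bouquet_def free_def)
  note bv = bouquet_vector_non_mixed[OF assms(1) nonmixed assms(3)]
  have freec: "vsupp (c b) = Bq b" if "free b" for b
    using assms(3)[of b] that by (simp add: bouquet_vector_def free_def)
  have free_ker: "u $ i = 0" if "u \<in> int_ker A" "free (\<beta> i)" for u i
    using free_vector_ker[OF _ that(1), of i] that(2) \<beta>[of i "\<beta> i"] by (auto simp: free_def free_bouquet_def)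
  have c0: "c b $ i = 0" if "i \<notin> Bq b" for b i
    using freec bv(2) that by (cases "free b") (auto simp: vsupp_def)
  have cnz: "c b $ i \<noteq> 0" if "i \<in> Bq b" for b i
    using freec bv(1) that by (cases "free b") (fastforce simp: vsupp_def)+
  have map_nth: "bouquet_map c u $ i = u $ \<beta> i * c (\<beta> i) $ i" for u i
  proof -
    have "bouquet_map c u $ i = (\<Sum>b\<in>UNIV. u $ b * c b $ i)" by (simp add: bouquet_map_def)
    also have "\<dots> = (\<Sum>b\<in>{\<beta> i}. u $ b * c b $ i)"
      by (rule sum.mono_neutral_right) (auto simp: c0 \<beta>[symmetric])
    finally show ?thesis by simp
  qed
  \<comment> \<open>The entries of \<open>c\<^sub>B\<close> for the free bouquet may be negative or have a common factor; since kernel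
    vectors vanish there, weight \<open>1\<close> gives the same map on the kernel.\<close>
  define d where "d i = (if free (\<beta> i) then 1 else nat (c (\<beta> i) $ i))" for i
  have dpos: "0 < d i" for i using bv(1)[of "\<beta> i" i] \<beta>[of i "\<beta> i"] by (simp add: d_def)
  have surj: "surj \<beta>" unfolding surj_def using nonempty[OF Bq] \<beta> by (metis all_not_in_conv)
  interpret stretching \<beta> d by unfold_locales (fact surj, fact dpos)
  have ker': "u \<in> int_ker ?A' \<longleftrightarrow> bouquet_map c u \<in> int_ker A" for u
    by (simp add: int_ker_def bouquet_matrix_mult)
  have eq: "bouquet_map c u = stretch u" if "\<And>b. free b \<Longrightarrow> u $ b = 0" for u
  proof (subst vec_eq_iff, rule allI)
    fix i
    show "bouquet_map c u $ i = stretch u $ i"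
      using that[of "\<beta> i"] bv(1)[of "\<beta> i" i] \<beta>[of i "\<beta> i"]
      by (cases "free (\<beta> i)") (simp_all add: map_nth d_def mult.commute)
  qed
  have zero': "u $ b = 0" if "u \<in> int_ker ?A'" "free b" for u b
  proof -
    obtain i where i: "\<beta> i = b" using ex_preimage by blast
    have "bouquet_map c u $ i = 0" using free_ker[of "bouquet_map c u" i] ker' that i by simp
    then show ?thesis using cnz[of i b] i \<beta>[of i b] by (simp add: map_nth)
  qed
  have zero: "u $ b = 0" if "stretch u \<in> int_ker A" "free b" for u b
  proof -
    obtain i where i: "\<beta> i = b" using ex_preimage by blast
    then show ?thesis using free_ker[OF that(1), of i] that(2) dpos[of i] by simp
  qed
  have map: "bouquet_map c u = stretch u" if "u \<in> int_ker ?A'" for u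
    using eq zero' that by blast
  interpret kernel_stretching \<beta> d A ?A'
  proof
    fix u show "stretch u \<in> int_ker A \<longleftrightarrow> u \<in> int_ker ?A'"
      using eq[of u] zero[of u] map[of u] ker'[of u] by metis
  next
    show "int_ker A \<subseteq> range stretch"
    proof
      fix u assume u: "u \<in> int_ker A"
      have "\<exists>t. \<forall>i\<in>Bq b. u $ i = t * int (d i)" for b
      proof (cases "free b")
        case True
        then show ?thesis using free_ker[OF u] by (intro exI[of _ 0]) (auto simp flip: \<beta>)
      next
        case False
        obtain t where "\<forall>i\<in>Bq b. u $ i = t * c b $ i" using bv(4)[OF False u] by blast
        then show ?thesis using bv(1)[OF False] False
          by (intro exI[of _ t]) (auto simp: d_def order_less_imp_le simp flip: \<beta>)
      qed
      then obtain t where t: "\<forall>i\<in>Bq b. u $ i = t b * int (d i)" for b by metis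
      have "u = stretch (\<chi> b. t b)"
        using t by (simp add: vec_eq_iff mult.commute flip: \<beta>)
      then show "u \<in> range stretch" by blast
    qed
  next
    fix b
    show "Gcd (d ` {i. \<beta> i = b}) = 1"
    proof (cases "free b")
      case True
      then have "d ` {i. \<beta> i = b} = {1}"
        using nonempty[OF Bq, of b] by (auto simp: d_def image_iff simp flip: fibre)
      then show ?thesis by simp
    next
      case False
      have "int ` d ` Bq b = (\<lambda>i. c b $ i) ` Bq b"
        unfolding image_image
      proof (rule image_cong[OF refl])
        fix i assume "i \<in> Bq b"
        then show "int (d i) = c b $ i" using bv(1)[OF False, of i] False \<beta>[of i b] by (auto simp: d_def)
      qed
      then have "int (Gcd (d ` Bq b)) = 1" using bv(3)[OF False] by (simp flip: Gcd_int_eq)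
      then show ?thesis by (simp add: fibre)
    qed
  qed
  have 1: "bij_betw (bouquet_map c) S' S \<longleftrightarrow> bij_betw stretch S' S" if "S' \<subseteq> int_ker ?A'" for S' S
    by (rule bij_betw_cong) (use map that in blast)
  have 2: "bij_betw (\<lambda>U. bouquet_map c ` U) \<S>' \<S> \<longleftrightarrow> bij_betw (\<lambda>U. stretch ` U) \<S>' \<S>"
    if "\<And>U. U \<in> \<S>' \<Longrightarrow> U \<subseteq> int_ker ?A'" for \<S>' \<S>
    by (rule bij_betw_cong, rule image_cong[OF refl], rule map) (use that in blast)
  have sub: "int_ker ?A' \<subseteq> int_ker ?A'" "graver_basis ?A' \<subseteq> int_ker ?A'" "circuits ?A' \<subseteq> int_ker ?A'"
    "indispensables TYPE('k) ?A' \<subseteq> int_ker ?A'" "universal_groebner_basis TYPE('k) ?A' \<subseteq> int_ker ?A'"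
    "\<And>U. U \<in> minimal_markov_bases TYPE('k) ?A' \<Longrightarrow> U \<subseteq> int_ker ?A'"
    "\<And>U. U \<in> reduced_groebner_bases TYPE('k) ?A' \<Longrightarrow> U \<subseteq> int_ker ?A'"
    by (auto simp: graver_basis_def circuits_def indispensables_def universal_groebner_basis_def
        minimal_markov_bases_def markov_basis_def reduced_groebner_bases_def)
  show ?thesis
    by (intro conjI iffD2[OF 1[OF sub(1)]] iffD2[OF 1[OF sub(2)]] iffD2[OF 1[OF sub(3)]]
        iffD2[OF 1[OF sub(4)]] iffD2[OF 1[OF sub(5)]] iffD2[OF 2[OF sub(6)]] iffD2[OF 2[OF sub(7)]]
        bij_betw_int_ker bij_betw_graver bij_betw_circuits bij_betw_indispensables
        bij_betw_minimal_markov bij_betw_reduced_groebner_bases[OF monomial_order_lex]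
        bij_betw_universal_groebner_basis[OF monomial_order_lex])
qed

end
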